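(* For every $Q\in\mathbb{R}^n$, $$\hat L(Q)=\sup_{\theta}\ \sup_{P,u}\ \int_{\mathbb{T}^n}\ \inf_{v\in\mathbb{R}^n}\big[L(x,v)+u(x+v)-u(x)+P\cdot(v-Q)\big]\,\theta(dx),$$ where the first supremum is over all Borel probability measures $\theta$ on $\mathbb{T}^n$ and the second over all $P\in\mathbb{R}^n$ and all continuous $u:\mathbb{T}^n\to\mathbb{R}$.
   Context: $\mathbb{T}^n$ is the $n$-torus $\mathbb{R}^n/\mathbb{Z}^n$; $x+v\in\mathbb{T}^n$ for $x\in\mathbb{T}^n$, $v\in\mathbb{R}^n$ is taken mod $\mathbb{Z}^n$. The Lagrangian $L:\mathbb{T}^n\times\mathbb{R}^n\to\mathbb{R}$ is smooth, strictly convex in $v$ with $D^2_{vv}L(x,v)\ge\gamma>0$ for some constant $\gamma$, and coercive: $\lim_{|v|\to\infty}L(x,v)/|v|=\infty$. For a Borel probability measure $\theta$ on $\mathbb{T}^n$ and $Q\in\mathbb{R}^n$, $\Pi(\theta,Q)$ is the set of plans $\pi$, i.e. (measurable) families $\pi(x,dv)$, $x\in\mathbb{T}^n$, of Borel probability measures on $\mathbb{R}^n$, such that $\int \phi(x+v)\,\pi(x,dv)\,\theta(dx)=\int\phi(x)\,\theta(dx)$ for all continuous $\phi:\mathbb{T}^n\to\mathbb{R}$, and $\int v\,\pi(x,dv)\,\theta(dx)=Q$. The minimax effective Lagrangian is $$\hat L(Q)=\sup_\theta\ \inf_{\pi\in\Pi(\theta,Q)}\int L(x,v)\,\pi(x,dv)\,\theta(dx),$$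 the supremum being over all Borel probability measures $\theta$ on $\mathbb{T}^n$. *)

theory Defs
  imports "HOL-Probability.Probability"
begin

text \<open>The torus \<open>\<real>\<^sup>n / \<int>\<^sup>n\<close> with \<open>n = CARD('n)\<close>, carrying the quotient topology;
  \<open>abs_torus\<close> is the projection.\<close>

quotient_type (overloaded) 'n torus = "real ^ 'n::finite" /
  "\<lambda>x y. \<forall>i. x $ i - y $ i \<in> \<int>"
proof (rule equivpI)
  show "reflp (\<lambda>x y :: real ^ 'n. \<forall>i. x $ i - y $ i \<in> \<int>)"
    by (auto intro: reflpI)
  show "symp (\<lambda>x y :: real ^ 'n. \<forall>i. x $ i - y $ i \<in> \<int>)"
    by (rule sympI) (metis Ints_minus minus_diff_eq)
  show "transp (\<lambda>x y :: real ^ 'n. \<forall>i. x $ i - y $ i \<in> \<int>)"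
  proof (rule transpI, rule allI)
    fix x y z :: "real ^ 'n" and i
    assume "\<forall>i. x $ i - y $ i \<in> \<int>" "\<forall>i. y $ i - z $ i \<in> \<int>"
    then have "(x $ i - y $ i) + (y $ i - z $ i) \<in> \<int>" by (intro Ints_add) auto
    then show "x $ i - z $ i \<in> \<int>" by simp
  qed
qed

instantiation torus :: (finite) topological_space
begin

definition open_torus :: "'a torus set \<Rightarrow> bool" where
  "open_torus U \<longleftrightarrow> open (abs_torus -` U)"

instance
  by standard (auto simp: open_torus_def vimage_Union)

end

lift_definition torus_add :: "'n::finite torus \<Rightarrow> real ^ 'n \<Rightarrow> 'n torus" (infixl "+\<^sub>T" 65)
  is "\<lambda>x v. x + v"
  by simp

text \<open>\<open>C_k k f\<close>: \<open>f\<close> is of class \<open>C\<^sup>k\<close> on the whole space.\<close>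

primrec C_k :: "nat \<Rightarrow> ('a::euclidean_space \<Rightarrow> real) \<Rightarrow> bool" where
  "C_k 0 f \<longleftrightarrow> continuous_on UNIV f"
| "C_k (Suc k) f \<longleftrightarrow>
     f differentiable_on UNIV \<and> (\<forall>h. C_k k (\<lambda>x. frechet_derivative f (at x) h))"

text \<open>Smoothness of a function on \<open>\<T>\<^sup>n \<times> \<real>\<^sup>n\<close> is smoothness of its lift to \<open>\<real>\<^sup>n \<times> \<real>\<^sup>n\<close>.\<close>

definition smooth_lagrangian :: "('n::finite torus \<Rightarrow> real ^ 'n \<Rightarrow> real) \<Rightarrow> bool" where
  "smooth_lagrangian L \<longleftrightarrow>
     (\<forall>k. C_k k (\<lambda>(x, v). L (abs_torus x) v))"

definition strictly_convex :: "('a::real_vector \<Rightarrow> real) \<Rightarrow> bool" where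
  "strictly_convex f \<longleftrightarrow>
     (\<forall>v w t. v \<noteq> w \<longrightarrow> 0 < t \<longrightarrow> t < 1 \<longrightarrow>
        f ((1 - t) *\<^sub>R v + t *\<^sub>R w) < (1 - t) * f v + t * f w)"

definition second_derivative ::
    "('a::real_normed_vector \<Rightarrow> real) \<Rightarrow> 'a \<Rightarrow> 'a \<Rightarrow> 'a \<Rightarrow> real" where
  "second_derivative f v w w' =
     frechet_derivative (\<lambda>y. frechet_derivative f (at y) w) (at v) w'"

text \<open>The matrix inequality \<open>D\<^sup>2\<^sub>v\<^sub>v L \<ge> \<gamma>\<close> is read in the sense of quadratic forms.\<close>

definition lagrangian :: "real \<Rightarrow> ('n::finite torus \<Rightarrow> real ^ 'n \<Rightarrow> real) \<Rightarrow> bool" where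
  "lagrangian \<gamma> L \<longleftrightarrow>
     smooth_lagrangian L \<and>
     (\<forall>x. strictly_convex (L x)) \<and>
     (\<forall>x v w. second_derivative (L x) v w w \<ge> \<gamma> * (norm w)\<^sup>2) \<and>
     (\<forall>x. filterlim (\<lambda>v. L x v / norm v) at_top at_infinity)"

text \<open>The extended integral \<open>\<integral>f\<^sup>+ - \<integral>f\<^sup>-\<close>. The Bochner integral would assign the value 0
  to functions with integral \<open>\<infinity>\<close>. All integrands below are bounded from below, so that
  \<open>\<infinity> - \<infinity>\<close> does not occur.\<close>

definition ext_integral :: "'a measure \<Rightarrow> ('a \<Rightarrow> ereal) \<Rightarrow> ereal" where
  "ext_integral M f =
     enn2ereal (\<integral>\<^sup>+z. e2ennreal (f z) \<partial>M) - enn2ereal (\<integral>\<^sup>+z. e2ennreal (- f z) \<partial>M)"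

text \<open>\<open>plan_measure \<theta> \<pi>\<close> is the measure \<open>\<pi>(x, dv) \<theta>(dx)\<close> on \<open>\<T>\<^sup>n \<times> \<real>\<^sup>n\<close>.\<close>

definition plan_measure ::
    "'n::finite torus measure \<Rightarrow> ('n torus \<Rightarrow> (real ^ 'n) measure) \<Rightarrow>
     ('n torus \<times> (real ^ 'n)) measure" where
  "plan_measure \<theta> \<pi> = \<theta> \<bind> (\<lambda>x. distr (\<pi> x) (borel \<Otimes>\<^sub>M borel) (Pair x))"

definition plans ::
    "'n::finite torus measure \<Rightarrow> real ^ 'n \<Rightarrow> ('n torus \<Rightarrow> (real ^ 'n) measure) set" where
  "plans \<theta> Q = {\<pi> \<in> borel \<rightarrow>\<^sub>M prob_algebra borel.
     (\<forall>\<phi> :: 'n torus \<Rightarrow> real. continuous_on UNIV \<phi> \<longrightarrow>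
        (\<integral>(x, v). \<phi> (x +\<^sub>T v) \<partial>plan_measure \<theta> \<pi>) = (\<integral>x. \<phi> x \<partial>\<theta>)) \<and>
     integrable (plan_measure \<theta> \<pi>) (\<lambda>(x, v). v) \<and>
     (\<integral>(x, v). v \<partial>plan_measure \<theta> \<pi>) = Q}"

text \<open>\<open>space (prob_algebra borel)\<close> is the set of all Borel probability measures.\<close>

definition minimax_lagrangian ::
    "('n::finite torus \<Rightarrow> real ^ 'n \<Rightarrow> real) \<Rightarrow> real ^ 'n \<Rightarrow> ereal" where
  "minimax_lagrangian L Q =
     (SUP \<theta> \<in> space (prob_algebra borel). INF \<pi> \<in> plans \<theta> Q.
        ext_integral (plan_measure \<theta> \<pi>) (\<lambda>(x, v). ereal (L x v)))"

end

theory Submission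
  imports Defs
begin

text \<open>For a fixed measure \<open>\<theta>\<close> the two sides are dual linear programmes: the plan is the primal
  variable, \<open>P\<close> is the multiplier of the constraint on the mean velocity and \<open>u\<close> the multiplier
  of the invariance of \<open>\<theta>\<close>. The inequality \<open>\<ge>\<close> is weak duality
  (\<open>dual_value_le_plan_cost\<close>): integrated against an admissible plan, the terms
  \<open>u(x+v) - u(x)\<close> and \<open>P \<bullet> (v - Q)\<close> vanish.

  For \<open>\<le>\<close>, let \<open>W\<close> be the right-hand side. Dirac measures show that
  \<open>inf\<^sub>v [L(x,v) + u(x+v) - u(x) + P \<bullet> (v - Q)] \<le> W\<close> at every point \<open>x\<close> and for all
  \<open>P\<close> and \<open>u\<close>. This uniform bound replaces duality in infinite dimensions: it is enough to
  construct, for every \<open>\<theta>\<close> and \<open>\<epsilon> > 0\<close>, an admissible plan of cost at most \<open>W + 2\<epsilon>\<close>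
  (\<open>near_optimal_plan\<close>).

  To do so, the torus is cut into small cells with representatives in a finite set \<open>F\<close>, and
  one looks for masses \<open>q(a,b,z)\<close> that are transported from the cell of \<open>a\<close> to the cell of
  \<open>b\<close> with the velocity \<open>b - a + z\<close>, where \<open>z\<close> is an integer vector of bounded length. This
  is a finite linear programme. Its duality (\<open>finite_transport_duality\<close>) is proved by
  introducing one Lagrange multiplier after the other, each time by separating convex sets in
  the plane. If no \<open>q\<close> of cost at most \<open>W + \<epsilon>\<close> existed, the multipliers would be a vector
  \<open>P\<close> and a function \<open>u\<close> on \<open>F\<close>; placing a steep well with bottom \<open>u(b)\<close> at every \<open>b \<in> F\<close>
  turns \<open>u\<close> into a continuous function on the torus for which the infimum over \<open>v\<close> exceeds
  \<open>W\<close> at some point of \<open>F\<close> (\<open>discrete_dual_below_value\<close>), a contradiction.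

  Given a cheap \<open>q\<close>, its masses are spread over the cells in proportion to \<open>\<theta>\<close>: a point
  \<open>x\<close> in the cell of \<open>a\<close> jumps to a point \<open>y\<close> in the cell of \<open>b\<close>, distributed according
  to \<open>\<theta>\<close>, with velocity \<open>y - x + z\<close> (locale \<open>coupled_cells\<close>). Both \<open>x\<close> and \<open>y\<close> then have
  the law \<open>\<theta>\<close>, so the plan is admissible with mean exactly \<open>Q\<close>: the average of \<open>y - b\<close> and
  that of \<open>x - a\<close> cancel. The cost changes by at most \<open>\<epsilon>\<close>, by uniform continuity of \<open>L\<close>
  on a compact set that is fixed before the cells are chosen.\<close>

section \<open>The torus\<close>

lemma abs_torus_eq_iff: "abs_torus x = abs_torus y \<longleftrightarrow> (\<forall>i. x $ i - y $ i \<in> \<int>)"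
  by (rule torus.abs_eq_iff)

lemma abs_torus_add: "abs_torus x +\<^sub>T v = abs_torus (x + v)"
  by (rule torus_add.abs_eq)

lemma continuous_on_torus_iff:
  fixes f :: "'n::finite torus \<Rightarrow> 'b::topological_space"
  shows "continuous_on UNIV f \<longleftrightarrow> continuous_on UNIV (\<lambda>x. f (abs_torus x))"
  by (simp add: continuous_on_open_vimage open_torus_def vimage_def)

lemma continuous_on_abs_torus: "continuous_on S abs_torus"
proof -
  have "continuous_on UNIV (abs_torus :: real ^ 'a \<Rightarrow> 'a torus)"
    using continuous_on_torus_iff[of "\<lambda>x. x"] continuous_on_id by blast
  then show ?thesis by (rule continuous_on_subset) simp
qed

definition torus_cube :: "(real ^ 'n::finite) set" where
  "torus_cube = cbox 0 1"

lemma torus_cube_iff: "x \<in> torus_cube \<longleftrightarrow> (\<forall>i. 0 \<le> x $ i \<and> x $ i \<le> 1)"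
  by (simp add: torus_cube_def mem_box_cart)

lemma compact_torus_cube: "compact torus_cube"
  by (simp add: torus_cube_def)

lemma frac_eq_if_diff_Ints:
  fixes x y :: real
  assumes "x - y \<in> \<int>"
  shows "frac x = frac y"
proof -
  obtain k where "x - y = of_int k" using assms by (meson Ints_cases)
  then have "x = y + of_int k" by simp
  then show ?thesis by (simp add: frac_def)
qed

text \<open>A Borel section of the projection, the coordinatewise fractional part, transfers
  measurability questions on the torus to the Euclidean space.\<close>

lift_definition torus_rep :: "'n::finite torus \<Rightarrow> real ^ 'n" is "\<lambda>x. \<chi> i. frac (x $ i)"
  by (simp add: vec_eq_iff frac_eq_if_diff_Ints)

lemma abs_torus_rep [simp]: "abs_torus (torus_rep t) = t"
  by transfer (simp add: frac_def)

lemma torus_rep_in_cube: "torus_rep t \<in> torus_cube"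
  by transfer (simp add: torus_cube_iff frac_lt_1 less_imp_le)

text \<open>The section is not continuous, but each coordinate is lower semicontinuous: for
  \<open>0 \<le> c\<close> the condition \<open>c < frac x\<close> describes a union of open intervals.\<close>

lemma torus_rep_measurable [measurable]: "torus_rep \<in> borel_measurable borel"
proof (rule borel_measurable_euclidean_space[THEN iffD2], rule ballI)
  fix b :: "real ^ 'a" assume "b \<in> Basis"
  then obtain i where b: "b = axis i 1" by (auto simp: Basis_vec_def)
  have "open {t. c < torus_rep t $ i}" for c
  proof -
    have "{x::real. c < frac x} = (if c < 0 then UNIV else (\<Union>m::int. {of_int m + c <..< of_int m + 1}))"
    proof (cases "c < 0")
      case True then show ?thesis by (auto intro: less_le_trans)
    next
      case False
      have "(c < frac x) \<longleftrightarrow> (\<exists>m::int. of_int m + c < x \<and> x < of_int m + 1)" for x :: real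
      proof
        assume "c < frac x"
        then show "\<exists>m::int. of_int m + c < x \<and> x < of_int m + 1"
          by (intro exI[of _ "\<lfloor>x\<rfloor>"]) (auto simp: frac_def)
      next
        assume "\<exists>m::int. of_int m + c < x \<and> x < of_int m + 1"
        then obtain m :: int where m: "of_int m + c < x" "x < of_int m + 1" by auto
        then have "\<lfloor>x\<rfloor> = m" using False by (intro floor_unique) auto
        then show "c < frac x" using m by (simp add: frac_def)
      qed
      then show ?thesis using False by auto
    qed
    then have "open {x::real. c < frac x}" by auto
    then have "open ((\<lambda>x::real ^ 'a. x $ i) -` {x::real. c < frac x})"
      by (rule open_vimage) (intro continuous_intros)
    moreover have "abs_torus -` {t. c < torus_rep t $ i} = (\<lambda>x::real ^ 'a. x $ i) -` {x::real. c < frac x}"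
      by (auto simp: torus_rep.abs_eq)
    ultimately show ?thesis by (simp add: open_torus_def)
  qed
  then have "(\<lambda>t. torus_rep t $ i) \<in> borel_measurable borel"
    by (intro borel_measurableI_greater) simp
  then show "(\<lambda>t. torus_rep t \<bullet> b) \<in> borel_measurable borel"
    by (simp add: b inner_axis)
qed

lemma abs_torus_image_cube: "abs_torus ` torus_cube = UNIV"
proof (intro equalityI subset_UNIV subsetI)
  fix t :: "'a torus"
  have "abs_torus (torus_rep t) \<in> abs_torus ` torus_cube"
    by (intro imageI torus_rep_in_cube)
  then show "t \<in> abs_torus ` torus_cube" by simp
qed

lemma compact_UNIV_torus: "compact (UNIV :: 'n::finite torus set)"
  using compact_continuous_image[OF continuous_on_abs_torus compact_torus_cube]
  by (simp add: abs_torus_image_cube)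

lemma continuous_torus_bounded:
  fixes u :: "'n::finite torus \<Rightarrow> real"
  assumes "continuous_on UNIV u"
  obtains B where "\<And>x. \<bar>u x\<bar> \<le> B"
proof -
  have "bounded (u ` UNIV)"
    using compact_continuous_image[OF assms compact_UNIV_torus] by (rule compact_imp_bounded)
  then show ?thesis using that by (auto simp: bounded_iff)
qed

section \<open>Uniform growth of the Lagrangian\<close>

text \<open>Coercivity is assumed at each point separately. Near a point \<open>x\<^sub>0\<close>, choose a sphere
  \<open>|v| = r\<close> on which \<open>L(x\<^sub>0, v)\<close> exceeds \<open>L(x\<^sub>0, 0)\<close> by more than \<open>|A| r\<close>. By continuity
  this persists, with a smaller margin, for \<open>x\<close> near \<open>x\<^sub>0\<close>, and convexity along rays carries
  the slope \<open>|A|\<close> to all larger \<open>v\<close>. Compactness makes the constant uniform.\<close>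

lemma torus_uniform_superlinear:
  fixes L :: "'n::finite torus \<Rightarrow> real ^ 'n \<Rightarrow> real"
  assumes cont: "continuous_on UNIV (\<lambda>(x, v). L (abs_torus x) v)"
    and conv: "\<And>x. strictly_convex (L x)"
    and coer: "\<And>x. filterlim (\<lambda>v. L x v / norm v) at_top at_infinity"
  obtains B where "\<And>x v. L x v \<ge> A * norm v - B"
proof -
  let ?L = "\<lambda>x v. L (abs_torus x) v"
  have "\<exists>d>0. \<exists>B. \<forall>x\<in>ball x0 d \<inter> torus_cube. \<forall>v. ?L x v \<ge> A * norm v - B"
    if x0: "x0 \<in> torus_cube" for x0
  proof -
    obtain r0 where r0: "\<And>v. norm v \<ge> r0 \<Longrightarrow> ?L x0 v / norm v \<ge> \<bar>A\<bar> + 1"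
      using coer[of "abs_torus x0"] unfolding filterlim_at_top eventually_at_infinity by blast
    define r where "r = max 1 (max r0 (?L x0 0 + 2))"
    have r: "r \<ge> 1" "r \<ge> r0" "r \<ge> ?L x0 0 + 2" by (auto simp: r_def)
    let ?K = "torus_cube \<times> cball 0 r :: ((real ^ 'n) \<times> (real ^ 'n)) set"
    have K: "compact ?K" by (intro compact_Times compact_torus_cube compact_cball)
    have contK: "continuous_on ?K (\<lambda>(x, v). ?L x v)"
      using cont by (rule continuous_on_subset) simp
    have "uniformly_continuous_on ?K (\<lambda>(x, v). ?L x v)"
      using contK K by (rule compact_uniformly_continuous)
    then obtain d where d: "d > 0" "\<And>p q. p \<in> ?K \<Longrightarrow> q \<in> ?K \<Longrightarrow> dist q p < d \<Longrightarrow>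
        dist ((\<lambda>(x, v). ?L x v) q) ((\<lambda>(x, v). ?L x v) p) < 1"
      unfolding uniformly_continuous_on_def by (meson zero_less_one)
    have "bounded ((\<lambda>(x, v). ?L x v) ` ?K)"
      using compact_continuous_image[OF contK K] by (rule compact_imp_bounded)
    then obtain C where C: "\<And>x v. x \<in> torus_cube \<Longrightarrow> norm v \<le> r \<Longrightarrow> \<bar>?L x v\<bar> \<le> C"
      unfolding bounded_iff by fastforce
    have "?L x v \<ge> A * norm v - (C + \<bar>A\<bar> * r)" if x: "x \<in> ball x0 d \<inter> torus_cube" for x v
    proof (cases "norm v \<le> r")
      case True
      have "A * norm v \<le> \<bar>A\<bar> * r" using True by (intro mult_mono) auto
      then show ?thesis using C[of x v] x True by auto
    next
      case False
      define t where "t = r / norm v"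
      have nv: "norm v > 0" using False r by linarith
      have t: "0 < t" "t < 1" using False r nv by (auto simp: t_def)
      have nr: "norm (t *\<^sub>R v) = r" using nv r by (simp add: t_def)
      have near: "\<bar>?L x w - ?L x0 w\<bar> < 1" if "norm w \<le> r" for w
        using d(2)[of "(x0,w)" "(x,w)"] x x0 that by (auto simp: dist_Pair_Pair dist_commute dist_real_def)
      have "v \<noteq> 0" using nv by auto
      then have "?L x ((1 - t) *\<^sub>R 0 + t *\<^sub>R v) < (1 - t) * ?L x 0 + t * ?L x v"
        using conv[of "abs_torus x"] t unfolding strictly_convex_def by metis
      then have 1: "?L x (t *\<^sub>R v) < (1 - t) * ?L x 0 + t * ?L x v" by simp
      have "?L x0 (t *\<^sub>R v) / r \<ge> \<bar>A\<bar> + 1" using r0[of "t *\<^sub>R v"] nr r by simp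
      then have 2: "?L x0 (t *\<^sub>R v) \<ge> (\<bar>A\<bar> + 1) * r" using r by (simp add: field_simps)
      have 3: "?L x (t *\<^sub>R v) \<ge> (\<bar>A\<bar> + 1) * r - 1" using 2 near[of "t *\<^sub>R v"] nr by linarith
      have 4: "?L x 0 \<le> ?L x0 0 + 1" using near[of 0] r by simp
      have "t * (?L x v - ?L x 0) \<ge> \<bar>A\<bar> * r" using 1 3 4 r by (simp add: algebra_simps)
      then have "(?L x v - ?L x 0) * (r / norm v) \<ge> \<bar>A\<bar> * r" by (simp add: t_def mult.commute)
      then have "?L x v - ?L x 0 \<ge> \<bar>A\<bar> * norm v"
      proof -
        have "(\<bar>A\<bar> * norm v) * r \<le> (?L x v - ?L x 0) * r"
          using \<open>(?L x v - ?L x 0) * (r / norm v) \<ge> \<bar>A\<bar> * r\<close> nv by (simp add: field_simps)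
        then show ?thesis using r by simp
      qed
      moreover have "A * norm v \<le> \<bar>A\<bar> * norm v" by (intro mult_right_mono) auto
      moreover have "\<bar>?L x 0\<bar> \<le> C" using C[of x 0] x r by auto
      moreover have "0 \<le> \<bar>A\<bar> * r" using r by auto
      ultimately show ?thesis by linarith
    qed
    then show ?thesis using d(1) by blast
  qed
  then obtain d B where dB: "\<And>x0. x0 \<in> torus_cube \<Longrightarrow> d x0 > 0"
    "\<And>x0 x v. x0 \<in> torus_cube \<Longrightarrow> x \<in> ball x0 (d x0) \<Longrightarrow> x \<in> torus_cube \<Longrightarrow> ?L x v \<ge> A * norm v - B x0"
    by (metis IntI)
  have "torus_cube \<subseteq> (\<Union>x0\<in>torus_cube. ball x0 (d x0))" using dB(1) by force
  then obtain C where C: "C \<subseteq> torus_cube" "finite C" "torus_cube \<subseteq> (\<Union>x0\<in>C. ball x0 (d x0))"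
    by (rule compactE_image[OF compact_torus_cube, rotated]) auto
  have "L x v \<ge> A * norm v - (\<Sum>x0\<in>C. \<bar>B x0\<bar>)" for x v
  proof -
    obtain x0 where x0: "x0 \<in> C" "torus_rep x \<in> ball x0 (d x0)"
      using C(3) torus_rep_in_cube[of x] by blast
    have "\<bar>B x0\<bar> \<le> (\<Sum>x0\<in>C. \<bar>B x0\<bar>)" using x0(1) C(2) by (intro member_le_sum) auto
    moreover have "L x v \<ge> A * norm v - B x0"
      using dB(2)[OF _ x0(2) torus_rep_in_cube, of v] x0(1) C(1) by auto
    ultimately show ?thesis by linarith
  qed
  then show ?thesis by (rule that)
qed

section \<open>Lagrange multipliers\<close>

text \<open>The unknowns of a finite linear programme are real functions on an index set of arbitrary
  type, with the product topology. Affinity and convexity are therefore expressed by pointwise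
  convex combinations.\<close>

definition affine_functional :: "(('i \<Rightarrow> real) \<Rightarrow> real) \<Rightarrow> bool" where
  "affine_functional h \<longleftrightarrow> continuous_on UNIV h \<and>
     (\<forall>p q t. h (\<lambda>i. (1 - t) * p i + t * q i) = (1 - t) * h p + t * h q)"

definition convex_functions :: "('i \<Rightarrow> real) set \<Rightarrow> bool" where
  "convex_functions K \<longleftrightarrow>
     (\<forall>p\<in>K. \<forall>q\<in>K. \<forall>t. 0 \<le> t \<longrightarrow> t \<le> 1 \<longrightarrow> (\<lambda>i. (1 - t) * p i + t * q i) \<in> K)"

lemma affine_functional_add:
  "affine_functional f \<Longrightarrow> affine_functional g \<Longrightarrow> affine_functional (\<lambda>q. f q + g q)"
  unfolding affine_functional_def by (intro conjI continuous_on_add allI) (auto simp: distrib_left)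

lemma affine_functional_cmult:
  "affine_functional g \<Longrightarrow> affine_functional (\<lambda>q. c * g q)"
  unfolding affine_functional_def
  by (intro conjI continuous_on_mult continuous_on_const allI) (auto simp: distrib_left mult.left_commute)

lemma affine_functional_linear:
  assumes "finite M"
  shows "affine_functional (\<lambda>q. (\<Sum>m\<in>M. q m * k m) - c)"
  unfolding affine_functional_def
proof (intro conjI allI)
  show "continuous_on UNIV (\<lambda>q. (\<Sum>m\<in>M. q m * k m) - c)"
    by (intro continuous_intros continuous_on_product_coordinates)
  fix p q :: "'a \<Rightarrow> real" and t
  have "(\<Sum>m\<in>M. ((1 - t) * p m + t * q m) * k m) =
      (1 - t) * (\<Sum>m\<in>M. p m * k m) + t * (\<Sum>m\<in>M. q m * k m)"
    by (simp add: sum_distrib_left sum.distrib distrib_right mult.assoc)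
  then show "(\<Sum>m\<in>M. ((1 - t) * p m + t * q m) * k m) - c =
      (1 - t) * ((\<Sum>m\<in>M. p m * k m) - c) + t * ((\<Sum>m\<in>M. q m * k m) - c)"
    by (simp add: algebra_simps)
qed

text \<open>The image of \<open>K\<close> under \<open>(g, f)\<close> is a compact convex subset of the plane that does not meet
  the closed half-line \<open>{0} \<times> {..c}\<close>; the slope of a strictly separating line gives the
  multiplier. If that line is vertical, \<open>g\<close> times a constant is bounded below by a positive
  number on \<open>K\<close>, and a large multiple of it outweighs \<open>c - f\<close>, which is bounded on \<open>K\<close>.\<close>

lemma lagrange_multiplier_single:
  assumes K: "compact K" "convex_functions K"
    and f: "affine_functional f" and g: "affine_functional g"
    and pos: "\<And>q. q \<in> K \<Longrightarrow> g q = 0 \<Longrightarrow> c < f q"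
  shows "\<exists>l::real. \<forall>q\<in>K. c < f q + l * g q"
proof (cases "K = {}")
  case False
  let ?S = "(\<lambda>q. (g q, f q)) ` K"
  have cf: "continuous_on K f" and cg: "continuous_on K g"
    using f g unfolding affine_functional_def by (auto intro: continuous_on_subset)
  have "compact ?S"
    by (intro compact_continuous_image continuous_on_Pair cf cg K(1))
  moreover have "convex ?S"
    unfolding convex_alt
  proof (intro ballI allI impI)
    fix x y and t :: real assume xy: "x \<in> ?S" "y \<in> ?S" and t: "0 \<le> t \<and> t \<le> 1"
    then obtain p q where pq: "p \<in> K" "x = (g p, f p)" "q \<in> K" "y = (g q, f q)" by auto
    have "(\<lambda>i. (1 - t) * p i + t * q i) \<in> K"
      using K(2) pq t unfolding convex_functions_def by blast
    moreover have "(1 - t) *\<^sub>R x + t *\<^sub>R y =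
        (g (\<lambda>i. (1 - t) * p i + t * q i), f (\<lambda>i. (1 - t) * p i + t * q i))"
      using f g pq by (simp add: affine_functional_def)
    ultimately show "(1 - t) *\<^sub>R x + t *\<^sub>R y \<in> ?S" by blast
  qed
  moreover have "?S \<noteq> {}" using False by simp
  moreover have "closed ({0} \<times> {..c} :: (real \<times> real) set)" by (intro closed_Times) auto
  moreover have "convex ({0} \<times> {..c} :: (real \<times> real) set)" by (intro convex_Times) auto
  moreover have "({0} \<times> {..c}) \<inter> ?S = {}" using pos by force
  ultimately obtain ab b where sep: "\<forall>x\<in>{0} \<times> {..c}. inner ab x < b" "\<forall>x\<in>?S. inner ab x > b"
    using separating_hyperplane_closed_compact[of "{0} \<times> {..c}" ?S] by blast
  obtain \<alpha> \<beta> where ab: "ab = (\<alpha>, \<beta>)" by (cases ab)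
  have below: "\<beta> * s < b" if "s \<le> c" for s using sep(1) that by (auto simp: ab)
  have above: "b < \<alpha> * g q + \<beta> * f q" if "q \<in> K" for q using sep(2) that by (auto simp: ab)
  \<comment> \<open>Otherwise \<open>\<beta> s\<close> would be unbounded above along the half-line \<open>s \<le> c\<close>.\<close>
  have "\<beta> \<ge> 0"
  proof (rule ccontr)
    assume "\<not> \<beta> \<ge> 0"
    then have n: "\<beta> < 0" by simp
    have "\<beta> * min c (b / \<beta>) < b" by (rule below) simp
    moreover have "\<beta> * min c (b / \<beta>) \<ge> \<beta> * (b / \<beta>)" using n by (intro mult_left_mono_neg) auto
    ultimately show False using n by simp
  qed
  show ?thesis
  proof (cases "\<beta> = 0")
    case True
    then have b: "b > 0" using below[of c] by simp
    have "bounded (f ` K)" using compact_continuous_image[OF cf K(1)] by (rule compact_imp_bounded)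
    then obtain B where B: "\<And>q. q \<in> K \<Longrightarrow> \<bar>f q\<bar> \<le> B" unfolding bounded_iff by auto
    have "c < f q + (((\<bar>c\<bar> + \<bar>B\<bar> + 1) / b) * \<alpha>) * g q" if "q \<in> K" for q
    proof -
      have "((\<bar>c\<bar> + \<bar>B\<bar> + 1) / b) * b < ((\<bar>c\<bar> + \<bar>B\<bar> + 1) / b) * (\<alpha> * g q)"
        using above[OF that] True b by (intro mult_strict_left_mono) (auto intro!: divide_pos_pos)
      then show ?thesis using B[OF that] b by (simp add: mult.assoc)
    qed
    then show ?thesis by blast
  next
    case False
    then have bp: "\<beta> > 0" using \<open>\<beta> \<ge> 0\<close> by simp
    have "c < f q + (\<alpha> / \<beta>) * g q" if "q \<in> K" for q
    proof -
      have "\<beta> * c < \<beta> * (f q + (\<alpha> / \<beta>) * g q)"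
        using below[of c] above[OF that] bp by (simp add: algebra_simps)
      then show ?thesis using bp by simp
    qed
    then show ?thesis by blast
  qed
qed auto

text \<open>Imposing one constraint on \<open>K\<close> leaves a compact convex set, to which the induction
  hypothesis applies; the single-constraint case then removes that constraint at the price of
  its own multiplier.\<close>

lemma lagrange_multipliers:
  assumes "finite S" "compact K" "convex_functions K"
    "affine_functional f" "\<And>s. s \<in> S \<Longrightarrow> affine_functional (g s)"
    "\<And>q. q \<in> K \<Longrightarrow> (\<forall>s\<in>S. g s q = 0) \<Longrightarrow> c < f q"
  shows "\<exists>l. \<forall>q\<in>K. c < f q + (\<Sum>s\<in>S. l s * g s q)"
  using assms
proof (induction S arbitrary: K rule: finite_induct)
  case empty
  then show ?case by auto
next
  case (insert s S)
  let ?K = "{q \<in> K. g s q = 0}"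
  have gs: "affine_functional (g s)" using insert.prems by blast
  have "?K = K \<inter> g s -` {0}" by auto
  moreover have "closed (g s -` {0})"
    using gs unfolding affine_functional_def by (intro closed_vimage) auto
  ultimately have "compact ?K" using insert.prems(1) by (metis compact_Int_closed)
  moreover have "convex_functions ?K"
    using insert.prems(2) gs unfolding convex_functions_def affine_functional_def by simp
  ultimately have "\<exists>l. \<forall>q\<in>?K. c < f q + (\<Sum>s\<in>S. l s * g s q)"
    using insert.prems by (intro insert.IH) auto
  then obtain l where l: "\<And>q. q \<in> K \<Longrightarrow> g s q = 0 \<Longrightarrow> c < f q + (\<Sum>s\<in>S. l s * g s q)" by blast
  have "affine_functional (\<lambda>q. f q + (\<Sum>s\<in>S'. l s * g s q))" if "S' \<subseteq> S" for S'
    using finite_subset[OF that insert.hyps(1)] that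
  proof (induction S' rule: finite_induct)
    case empty
    then show ?case using insert.prems(3) by simp
  next
    case (insert s' S')
    have "affine_functional (\<lambda>q. l s' * g s' q)"
      using insert.prems \<open>\<And>s'. s' \<in> insert s S \<Longrightarrow> affine_functional (g s')\<close>
      by (intro affine_functional_cmult) auto
    from affine_functional_add[OF this insert.IH] show ?case
      using insert by (simp add: algebra_simps)
  qed
  then have "affine_functional (\<lambda>q. f q + (\<Sum>s\<in>S. l s * g s q))" by blast
  from lagrange_multiplier_single[OF insert.prems(1,2) this gs l]
  obtain k where k: "\<And>q. q \<in> K \<Longrightarrow> c < f q + (\<Sum>s\<in>S. l s * g s q) + k * g s q" by blast
  have "(\<Sum>s'\<in>S. (l(s := k)) s' * g s' q) = (\<Sum>s\<in>S. l s * g s q)" for q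
    using insert.hyps(2) by (intro sum.cong) auto
  then have "\<forall>q\<in>K. c < f q + (\<Sum>s'\<in>insert s S. (l(s := k)) s' * g s' q)"
    using k insert.hyps by (simp add: algebra_simps)
  then show ?case by blast
qed

section \<open>Duality for finite transport problems\<close>

lemma sum_selection:
  fixes k :: "'a \<times> 'p \<Rightarrow> real"
  assumes "finite F" "finite P" "\<And>a. a \<in> F \<Longrightarrow> \<sigma> a \<in> P"
  shows "(\<Sum>m\<in>F \<times> P. (if snd m = \<sigma> (fst m) then w (fst m) else 0) * k m) = (\<Sum>a\<in>F. w a * k (a, \<sigma> a))"
proof -
  have "(\<Sum>m\<in>F \<times> P. (if snd m = \<sigma> (fst m) then w (fst m) else 0) * k m) =
      (\<Sum>a\<in>F. \<Sum>p\<in>P. (if p = \<sigma> a then w a else 0) * k (a, p))"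
    by (simp add: sum.cartesian_product split_beta)
  also have "\<dots> = (\<Sum>a\<in>F. \<Sum>p\<in>P. if p = \<sigma> a then w a * k (a, p) else 0)"
    by (intro sum.cong) auto
  also have "\<dots> = (\<Sum>a\<in>F. w a * k (a, \<sigma> a))"
    using assms by (intro sum.cong) auto
  finally show ?thesis .
qed

text \<open>The unknowns are masses \<open>q(a, b, z)\<close>, moved from \<open>a\<close> to \<open>b\<close> in the mode \<open>z\<close>. The
  prescribed source masses cut out the compact convex set \<open>K\<close>; the target masses and the mean
  displacement are the constraints that receive the multipliers \<open>u\<close> and \<open>P\<close>. The resulting
  inequality on \<open>K\<close> is tested on plans that use a single move \<open>\<sigma>(a)\<close> from every \<open>a\<close>: the
  left-hand side becomes a \<open>w\<close>-average of the brackets \<open>cost + u(b) - u(a) + P \<bullet> (D - Q)\<close>,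
  so for some \<open>a\<close> none of them is at most \<open>c\<close>.\<close>

lemma finite_transport_duality:
  fixes F :: "'a set" and Z :: "'b set" and w :: "'a \<Rightarrow> real"
    and cost :: "'a \<times> 'a \<times> 'b \<Rightarrow> real" and D :: "'a \<times> 'a \<times> 'b \<Rightarrow> real ^ 'n::finite"
  assumes fin: "finite F" "finite Z" and w: "\<And>a. a \<in> F \<Longrightarrow> 0 \<le> w a" "(\<Sum>a\<in>F. w a) = 1"
    and infeasible: "\<And>q. (\<And>m. 0 \<le> q m) \<Longrightarrow>
      (\<And>a. a \<in> F \<Longrightarrow> (\<Sum>m\<in>F \<times> F \<times> Z. q m * of_bool (fst m = a)) = w a) \<Longrightarrow>
      (\<And>b. b \<in> F \<Longrightarrow> (\<Sum>m\<in>F \<times> F \<times> Z. q m * of_bool (fst (snd m) = b)) = w b) \<Longrightarrow>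
      (\<Sum>m\<in>F \<times> F \<times> Z. q m *\<^sub>R D m) = Q \<Longrightarrow>
      c < (\<Sum>m\<in>F \<times> F \<times> Z. q m * cost m)"
  obtains u P a where "a \<in> F"
    "\<And>b z. b \<in> F \<Longrightarrow> z \<in> Z \<Longrightarrow> c < cost (a, b, z) + u b - u a + P \<bullet> (D (a, b, z) - Q)"
proof -
  let ?M = "F \<times> F \<times> Z"
  have finM: "finite ?M" using fin by auto
  have w1: "w a \<le> 1" if "a \<in> F" for a
    using member_le_sum[of a F w] w fin that by auto
  define box where "box = Pi\<^sub>E UNIV (\<lambda>m. if m \<in> ?M then {0..1::real} else {0})"
  define row where "row a q = (\<Sum>m\<in>?M. q m * of_bool (fst m = a)) - w a" for a and q :: "'a \<times> 'a \<times> 'b \<Rightarrow> real"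
  define col where "col b q = (\<Sum>m\<in>?M. q m * of_bool (fst (snd m) = b)) - w b" for b and q :: "'a \<times> 'a \<times> 'b \<Rightarrow> real"
  define mean where "mean i q = (\<Sum>m\<in>?M. q m * D m $ i) - Q $ i" for i and q :: "'a \<times> 'a \<times> 'b \<Rightarrow> real"
  define f where "f q = (\<Sum>m\<in>?M. q m * cost m)" for q :: "'a \<times> 'a \<times> 'b \<Rightarrow> real"
  define K where "K = box \<inter> (\<Inter>a\<in>F. row a -` {0})"
  have aff: "affine_functional (row a)" "affine_functional (col a)" "affine_functional (mean i)" "affine_functional f"
    for a i
    unfolding row_def col_def mean_def f_def
    using affine_functional_linear[OF finM, where c = 0 and k = cost]
    by (auto simp del: sum_mult_of_bool_eq intro!: affine_functional_linear[OF finM])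
  have "compactin (product_topology (\<lambda>m. euclidean) UNIV) box"
    unfolding box_def compactin_PiE by auto
  then have "compact box" by (simp add: euclidean_product_topology)
  moreover have "closed (\<Inter>a\<in>F. row a -` {0})"
    using aff(1) unfolding affine_functional_def by (intro closed_INT ballI closed_vimage) auto
  ultimately have "compact K" unfolding K_def by (rule compact_Int_closed)
  moreover have "convex_functions K"
    unfolding convex_functions_def
  proof (intro ballI allI impI)
    fix p q t assume pq: "p \<in> K" "q \<in> K" and t: "0 \<le> t" "t \<le> (1::real)"
    let ?r = "\<lambda>m. (1 - t) * p m + t * q m"
    have "?r m \<in> (if m \<in> ?M then {0..1::real} else {0})" for m
    proof -
      have "p m \<in> (if m \<in> ?M then {0..1::real} else {0})" "q m \<in> (if m \<in> ?M then {0..1::real} else {0})"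
        using pq unfolding K_def box_def by (blast dest: PiE_mem[OF _ UNIV_I])+
      moreover have "convex (if m \<in> ?M then {0..1::real} else {0})" by auto
      ultimately show ?thesis using t unfolding convex_alt by force
    qed
    moreover have "row a ?r = 0" if "a \<in> F" for a
      using aff(1)[of a] pq that by (auto simp: affine_functional_def K_def)
    ultimately show "?r \<in> K" by (auto simp: K_def box_def PiE_iff)
  qed
  moreover have "\<And>q. q \<in> K \<Longrightarrow> (\<forall>s\<in>F <+> (UNIV :: 'n set). case_sum col mean s q = 0) \<Longrightarrow> c < f q"
  proof -
    fix q assume q: "q \<in> K" "\<forall>s\<in>F <+> (UNIV :: 'n set). case_sum col mean s q = 0"
    have colq: "col b q = 0" if "b \<in> F" for b using q(2)[rule_format, of "Inl b"] that by auto
    have meanq: "mean i q = 0" for i using q(2)[rule_format, of "Inr i"] by auto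
    show "c < f q"
      unfolding f_def
    proof (rule infeasible)
      show "0 \<le> q m" for m
      proof -
        have "q m \<in> (if m \<in> ?M then {0..1::real} else {0})"
          using q(1) unfolding K_def box_def by (blast dest: PiE_mem[OF _ UNIV_I])
        then show ?thesis by (auto split: if_splits)
      qed
      show "(\<Sum>m\<in>?M. q m * of_bool (fst m = a)) = w a" if "a \<in> F" for a
        using q(1) that by (auto simp: K_def row_def)
      show "(\<Sum>m\<in>?M. q m * of_bool (fst (snd m) = b)) = w b" if "b \<in> F" for b
        using colq[OF that] by (simp add: col_def)
      show "(\<Sum>m\<in>?M. q m *\<^sub>R D m) = Q"
        using meanq by (simp add: mean_def vec_eq_iff)
    qed
  qed
  moreover have "affine_functional (case_sum col mean s)" for s :: "'a + 'n"
    using aff by (cases s) auto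
  ultimately obtain l where l: "\<And>q. q \<in> K \<Longrightarrow>
      c < f q + (\<Sum>s\<in>F <+> (UNIV :: 'n set). l s * case_sum col mean s q)"
    using lagrange_multipliers[of "F <+> (UNIV :: 'n set)" K f "case_sum col mean" c] aff(4) fin by auto
  define u where "u b = l (Inl b)" for b
  define P :: "real ^ 'n" where "P = (\<chi> i. l (Inr i))"
  have uP: "c < f q + (\<Sum>b\<in>F. u b * col b q) + (\<Sum>i\<in>UNIV. P $ i * mean i q)" if "q \<in> K" for q
    using l[OF that] fin by (simp add: sum.Plus u_def P_def)
  have "\<exists>a\<in>F. \<forall>b\<in>F. \<forall>z\<in>Z. c < cost (a, b, z) + u b - u a + P \<bullet> (D (a, b, z) - Q)"
  proof (rule ccontr)
    assume "\<not> ?thesis"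
    then have "\<forall>a. \<exists>p. a \<in> F \<longrightarrow> p \<in> F \<times> Z \<and> cost (a, p) + u (fst p) - u a + P \<bullet> (D (a, p) - Q) \<le> c"
      by (fastforce simp: not_less)
    then obtain \<sigma> where \<sigma>: "\<And>a. a \<in> F \<Longrightarrow> \<sigma> a \<in> F \<times> Z"
      "\<And>a. a \<in> F \<Longrightarrow> cost (a, \<sigma> a) + u (fst (\<sigma> a)) - u a + P \<bullet> (D (a, \<sigma> a) - Q) \<le> c" by metis
    define q where "q m = (if m \<in> ?M then (if snd m = \<sigma> (fst m) then w (fst m) else 0) else 0)" for m
    have qsum: "(\<Sum>m\<in>?M. q m * k m) = (\<Sum>a\<in>F. w a * k (a, \<sigma> a))" for k
      using sum_selection[of F "F \<times> Z" \<sigma> w k] fin \<sigma>(1) by (simp add: q_def cong: sum.cong)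
    have "row a q = 0" if "a \<in> F" for a
      unfolding row_def qsum using fin that by simp
    then have "q \<in> K"
      using w w1 by (auto simp: K_def box_def PiE_iff q_def)
    moreover have "f q + (\<Sum>b\<in>F. u b * col b q) + (\<Sum>i\<in>UNIV. P $ i * mean i q) =
      (\<Sum>a\<in>F. w a * (cost (a, \<sigma> a) + u (fst (\<sigma> a)) - u a + P \<bullet> (D (a, \<sigma> a) - Q)))"
    proof -
      have "(\<Sum>b\<in>F. u b * (\<Sum>a\<in>F. w a * of_bool (fst (\<sigma> a) = b))) = (\<Sum>a\<in>F. w a * u (fst (\<sigma> a)))"
      proof -
        have "(\<Sum>b\<in>F. u b * (\<Sum>a\<in>F. w a * of_bool (fst (\<sigma> a) = b))) =
            (\<Sum>b\<in>F. \<Sum>a\<in>F. if fst (\<sigma> a) = b then w a * u b else 0)"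
          unfolding sum_distrib_left by (intro sum.cong) auto
        also have "\<dots> = (\<Sum>a\<in>F. \<Sum>b\<in>F. if fst (\<sigma> a) = b then w a * u b else 0)" by (rule sum.swap)
        also have "\<dots> = (\<Sum>a\<in>F. w a * u (fst (\<sigma> a)))"
          using \<sigma>(1) fin by (intro sum.cong) (auto simp: mem_Times_iff)
        finally show ?thesis .
      qed
      then have C: "(\<Sum>b\<in>F. u b * col b q) = (\<Sum>a\<in>F. w a * (u (fst (\<sigma> a)) - u a))"
        by (simp add: col_def qsum right_diff_distrib sum_subtractf mult.commute)
      have "(\<Sum>i\<in>UNIV. P $ i * (\<Sum>a\<in>F. w a * D (a, \<sigma> a) $ i)) = (\<Sum>a\<in>F. w a * (P \<bullet> D (a, \<sigma> a)))"
        unfolding inner_vec_def sum_distrib_left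
        by (subst sum.swap) (simp add: mult.left_commute)
      moreover have "P \<bullet> Q = (\<Sum>a\<in>F. w a * (P \<bullet> Q))" using w(2) by (simp flip: sum_distrib_right)
      moreover have "(\<Sum>i\<in>UNIV. P $ i * Q $ i) = P \<bullet> Q" by (simp add: inner_vec_def)
      ultimately have "(\<Sum>i\<in>UNIV. P $ i * mean i q) = (\<Sum>a\<in>F. w a * (P \<bullet> (D (a, \<sigma> a) - Q)))"
        by (simp add: mean_def qsum right_diff_distrib sum_subtractf inner_diff_right)
      then show ?thesis
        unfolding C f_def qsum by (simp flip: sum.distrib) (simp add: algebra_simps)
    qed
    moreover have "\<dots> \<le> (\<Sum>a\<in>F. w a * c)"
      using \<sigma>(2) w(1) by (intro sum_mono mult_left_mono)
    moreover have "(\<Sum>a\<in>F. w a * c) = c" using w(2) by (simp flip: sum_distrib_right)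
    ultimately show False using uP[of q] by linarith
  qed
  then show ?thesis using that by blast
qed

section \<open>Extending discrete multipliers to the torus\<close>

definition lattice_vectors :: "(real ^ 'n::finite) set" where
  "lattice_vectors = {z. \<forall>i. z $ i \<in> \<int>}"

lemma abs_torus_eq_iff_lattice: "abs_torus x = abs_torus y \<longleftrightarrow> x - y \<in> lattice_vectors"
  by (simp add: abs_torus_eq_iff lattice_vectors_def)

lemma abs_torus_add_lattice [simp]: "z \<in> lattice_vectors \<Longrightarrow> abs_torus (x + z) = abs_torus x"
  by (simp add: abs_torus_eq_iff_lattice)

lemma lattice_zero [simp]: "0 \<in> lattice_vectors"
  by (simp add: lattice_vectors_def)

lemma norm_le_coordinate_bound:
  fixes x :: "real ^ 'n::finite" and B :: real
  assumes "\<And>i. \<bar>x $ i\<bar> \<le> B"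
  shows "norm x \<le> CARD('n) * B"
proof -
  have "norm x \<le> (\<Sum>i\<in>UNIV. \<bar>x $ i\<bar>)" by (rule norm_le_l1_cart)
  also have "\<dots> \<le> (\<Sum>i\<in>(UNIV :: 'n set). B)" using assms by (intro sum_mono)
  finally show ?thesis by simp
qed

lemma norm_diff_torus_cube:
  assumes "a \<in> torus_cube" "b \<in> torus_cube"
  shows "norm (b - a :: real ^ 'n::finite) \<le> CARD('n)"
proof -
  have "\<bar>(b - a) $ i\<bar> \<le> 1" for i
    using assms by (auto simp: torus_cube_iff abs_le_iff) (smt (verit))+
  from norm_le_coordinate_bound[of "b - a", OF this] show ?thesis by simp
qed

lemma finite_vectors_if_finite_coordinates:
  fixes T :: "real set"
  assumes "finite T"
  shows "finite {x :: real ^ 'n::finite. \<forall>i. x $ i \<in> T}"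
proof -
  have "{x :: real ^ 'n. \<forall>i. x $ i \<in> T} \<subseteq> vec_lambda ` (PiE UNIV (\<lambda>_. T))"
  proof
    fix x :: "real ^ 'n" assume "x \<in> {x. \<forall>i. x $ i \<in> T}"
    then have "($) x \<in> PiE UNIV (\<lambda>_. T)" by auto
    then show "x \<in> vec_lambda ` (PiE UNIV (\<lambda>_. T))" by (metis imageI vec_nth_inverse)
  qed
  then show ?thesis by (rule finite_subset) (intro finite_imageI finite_PiE, simp_all add: assms)
qed

lemma finite_bounded_lattice_vectors:
  "finite {z :: real ^ 'n::finite. z \<in> lattice_vectors \<and> norm z \<le> r}"
proof (rule finite_subset)
  show "{z :: real ^ 'n. z \<in> lattice_vectors \<and> norm z \<le> r} \<subseteq> {z. \<forall>i. z $ i \<in> {k \<in> \<int>. \<bar>k\<bar> \<le> r}}"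
    using component_le_norm_cart order_trans by (fastforce simp: lattice_vectors_def)
  show "finite {z :: real ^ 'n. \<forall>i. z $ i \<in> {k \<in> \<int>. \<bar>k\<bar> \<le> r}}"
    by (intro finite_vectors_if_finite_coordinates finite_abs_int_segment)
qed

lemma infdist_lattice_translate:
  assumes "k \<in> lattice_vectors"
  shows "infdist (y + k) ((+) b ` lattice_vectors) = infdist y ((+) b ` lattice_vectors)"
proof -
  have img: "(+) k ` (+) b ` lattice_vectors = (+) b ` lattice_vectors"
  proof -
    have "w \<in> (+) k ` (+) b ` lattice_vectors \<longleftrightarrow> w \<in> (+) b ` lattice_vectors" for w
    proof
      assume "w \<in> (+) k ` (+) b ` lattice_vectors"
      then obtain z where z: "z \<in> lattice_vectors" "w = k + (b + z)" by auto
      then have "k + z \<in> lattice_vectors" using assms by (simp add: lattice_vectors_def)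
      moreover have "w = b + (k + z)" using z by simp
      ultimately show "w \<in> (+) b ` lattice_vectors" by blast
    next
      assume "w \<in> (+) b ` lattice_vectors"
      then obtain z where z: "z \<in> lattice_vectors" "w = b + z" by auto
      then have "z - k \<in> lattice_vectors" using assms by (simp add: lattice_vectors_def)
      moreover have "w = k + (b + (z - k))" using z by simp
      ultimately show "w \<in> (+) k ` (+) b ` lattice_vectors" by blast
    qed
    then show ?thesis by blast
  qed
  have "infdist (y + k) ((+) k ` A) = infdist y A" for A
  proof -
    have "dist (y + k) (k + a) = dist y a" for a by (simp add: dist_norm)
    then show ?thesis by (simp add: infdist_def image_image)
  qed
  from this[of "(+) b ` lattice_vectors"] show ?thesis unfolding img .
qed

lemma continuous_on_Min_image:
  fixes f :: "'a \<Rightarrow> 'b::topological_space \<Rightarrow> real"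
  assumes "finite F" "F \<noteq> {}" "\<And>b. b \<in> F \<Longrightarrow> continuous_on S (f b)"
  shows "continuous_on S (\<lambda>x. Min ((\<lambda>b. f b x) ` F))"
  using assms
proof (induction F rule: finite_ne_induct)
  case (singleton b)
  then show ?case by simp
next
  case (insert b F)
  then show ?case by (auto intro!: continuous_on_min)
qed

text \<open>The distance to the translated lattice \<open>b + \<int>\<^sup>n\<close> is the distance on the torus to the class
  of \<open>b\<close>. The function \<open>U\<close> consists of cones of slope \<open>K\<close> over the points of \<open>F\<close>, with
  prescribed heights \<open>u\<close>.\<close>

lemma continuous_on_torus_wells:
  fixes u :: "(real ^ 'n::finite) \<Rightarrow> real"
  assumes F: "finite F" "F \<noteq> {}"
  obtains U :: "'n torus \<Rightarrow> real" where "continuous_on UNIV U"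
    "\<And>y. U (abs_torus y) = Min ((\<lambda>b. u b + K * infdist y ((+) b ` lattice_vectors)) ` F)"
proof -
  let ?U = "\<lambda>y. Min ((\<lambda>b. u b + K * infdist y ((+) b ` lattice_vectors)) ` F)"
  have per: "?U x = ?U y" if "abs_torus x = abs_torus y" for x y
  proof -
    have "infdist x ((+) b ` lattice_vectors) = infdist y ((+) b ` lattice_vectors)" for b
      using infdist_lattice_translate[of "x - y" y b] that by (simp add: abs_torus_eq_iff_lattice)
    then show ?thesis by simp
  qed
  define U where "U t = ?U (torus_rep t)" for t
  have U: "U (abs_torus y) = ?U y" for y unfolding U_def by (rule per) simp
  have "continuous_on UNIV ?U"
    using F by (intro continuous_on_Min_image continuous_intros)
  then have "continuous_on UNIV U" by (simp add: continuous_on_torus_iff U)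
  then show ?thesis using U that by blast
qed

text \<open>The discrete counterpart of the pointwise bound: multipliers \<open>u\<close>, \<open>P\<close> on a finite set of
  points cannot make all brackets larger than \<open>V + \<epsilon>\<close> if continuous \<open>u\<close> cannot push the
  infimum above \<open>V\<close>. It is essential that the range \<open>\<rho>\<close> of admissible integer shifts is the
  same for all finite sets.

  Suppose all brackets at \<open>a\<close> are larger. Integer velocities \<open>z\<close> on the far side of \<open>Q\<close> with
  respect to \<open>P\<close>, for which \<open>b = a\<close>, bound \<open>P\<close>; the unshifted velocities \<open>b - a\<close> then
  bound \<open>u(b) - u(a)\<close> below. Both bounds depend only on \<open>L\<close>, \<open>Q\<close> and \<open>V\<close>, so that by
  superlinear growth velocities beyond a radius \<open>R\<close> are too expensive, whatever \<open>F\<close> is. For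
  shorter velocities, a steep well function \<open>U\<close> is large unless the endpoint is close to a
  point of \<open>b + \<int>\<^sup>n\<close>, and there the bracket is close to one of the discrete brackets.\<close>

lemma discrete_dual_below_value:
  fixes L :: "'n::finite torus \<Rightarrow> real ^ 'n \<Rightarrow> real"
  assumes cont: "continuous_on UNIV (\<lambda>(x, v). L (abs_torus x) v)"
    and superlinear: "\<And>A. \<exists>B. \<forall>x v. L x v \<ge> A * norm v - B"
    and val: "\<And>P u x. continuous_on UNIV u \<Longrightarrow>
      (INF v. ereal (L x v + u (x +\<^sub>T v) - u x + P \<bullet> (v - Q))) \<le> ereal V"
    and \<epsilon>: "\<epsilon> > 0"
  obtains \<rho> where "\<And>F u P a. finite F \<Longrightarrow> F \<subseteq> torus_cube \<Longrightarrow> a \<in> F \<Longrightarrow>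
    \<exists>b\<in>F. \<exists>z\<in>lattice_vectors. norm z \<le> \<rho> \<and>
      L (abs_torus a) (b - a + z) + u b - u a + P \<bullet> (b - a + z - Q) \<le> V + \<epsilon>"
proof -
  let ?n = "real CARD('n)"
  \<comment> \<open>The radius \<open>r\<close> covers both the velocities \<open>b - a\<close> and the integer vectors next to \<open>Q\<close>.\<close>
  define r where "r = ?n * (norm Q + 2)"
  have n1: "?n \<ge> 1" by (simp add: Suc_leI)
  have r_ge: "r \<ge> ?n" "r \<ge> 0" unfolding r_def using n1 by (auto simp: mult_le_cancel_left1)
  have "bounded ((\<lambda>(x, v). L (abs_torus x) v) ` (torus_cube \<times> cball 0 r))"
    by (intro compact_imp_bounded compact_continuous_image compact_Times compact_torus_cube compact_cball
        continuous_on_subset[OF cont]) auto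
  then obtain B1 where B1: "\<And>x v. x \<in> torus_cube \<Longrightarrow> norm v \<le> r \<Longrightarrow> \<bar>L (abs_torus x) v\<bar> \<le> B1"
    unfolding bounded_iff by fastforce
  define C1 where "C1 = B1 + \<bar>V\<bar>"
  define C2 where "C2 = \<bar>V\<bar> + B1 + C1 * (?n + norm Q)"
  obtain B2 where B2: "\<And>x v. L x v \<ge> (C1 + 1) * norm v - B2" using superlinear by blast
  define R where "R = max 0 (V + \<epsilon> + B2 + C2 + C1 * norm Q)"
  define \<rho> where "\<rho> = max r (R + 1 + ?n)"
  have claim: "\<exists>b\<in>F. \<exists>z\<in>lattice_vectors. norm z \<le> \<rho> \<and>
      L (abs_torus a) (b - a + z) + u b - u a + P \<bullet> (b - a + z - Q) \<le> V + \<epsilon>"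
    if F: "finite F" "F \<subseteq> torus_cube" and a: "a \<in> F" for F u P a
  proof (rule ccontr)
    assume "\<not> ?thesis"
    then have gt: "V + \<epsilon> < L (abs_torus a) (b - a + z) + u b - u a + P \<bullet> (b - a + z - Q)"
      if "b \<in> F" "z \<in> lattice_vectors" "norm z \<le> \<rho>" for b z using that by (meson not_less)
    have ac: "a \<in> torus_cube" using F a by auto
    \<comment> \<open>Moving every coordinate of \<open>Q\<close> by at least one against the sign of \<open>P\<close> gives an integer
      vector \<open>z\<close> with \<open>P \<bullet> (z - Q) \<le> - |P|\<close>.\<close>
    have P: "norm P \<le> C1"
    proof -
      define z :: "real ^ 'n" where "z = (\<chi> i. if P $ i \<ge> 0 then of_int \<lfloor>Q $ i\<rfloor> - 1 else of_int \<lceil>Q $ i\<rceil> + 1)"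
      have "\<bar>z $ i\<bar> \<le> norm Q + 2" for i
      proof -
        have "\<bar>z $ i - Q $ i\<bar> \<le> 2" by (simp add: z_def) linarith
        then show ?thesis using component_le_norm_cart[of Q i] by linarith
      qed
      then have nz: "norm z \<le> r" unfolding r_def by (rule norm_le_coordinate_bound)
      have "z \<in> lattice_vectors" by (auto simp: lattice_vectors_def z_def)
      moreover have "norm z \<le> \<rho>" using nz by (simp add: \<rho>_def)
      ultimately have "V + \<epsilon> < L (abs_torus a) z + P \<bullet> (z - Q)" using gt[OF a] by fastforce
      moreover have "P \<bullet> (z - Q) \<le> - (\<Sum>i\<in>UNIV. \<bar>P $ i\<bar>)"
        unfolding inner_vec_def sum_negf[symmetric]
      proof (intro sum_mono)
        fix i
        show "P $ i \<bullet> (z - Q) $ i \<le> - \<bar>P $ i\<bar>"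
        proof (cases "P $ i \<ge> 0")
          case True
          have "(z - Q) $ i \<le> -1" using True by (simp add: z_def)
          then have "P $ i * (z - Q) $ i \<le> P $ i * (-1)" using True by (intro mult_left_mono)
          then show ?thesis using True by simp
        next
          case False
          have "(z - Q) $ i \<ge> 1" using False by (simp add: z_def)
          then have "P $ i * (z - Q) $ i \<le> P $ i * 1" using False by (intro mult_left_mono_neg) auto
          then show ?thesis using False by simp
        qed
      qed
      moreover have "norm P \<le> (\<Sum>i\<in>UNIV. \<bar>P $ i\<bar>)" by (rule norm_le_l1_cart)
      moreover have "L (abs_torus a) z \<le> B1" using B1[OF ac nz] by simp
      ultimately show ?thesis using \<epsilon> unfolding C1_def by linarith
    qed
    have C1_nonneg: "C1 \<ge> 0" using P norm_ge_zero order_trans by blast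
    have ub: "u b - u a \<ge> - C2" if b: "b \<in> F" for b
    proof -
      have nba: "norm (b - a) \<le> ?n" using norm_diff_torus_cube F a b by blast
      have "V + \<epsilon> < L (abs_torus a) (b - a) + u b - u a + P \<bullet> (b - a - Q)"
        using gt[OF b lattice_zero] r_ge by (simp add: \<rho>_def)
      moreover have "L (abs_torus a) (b - a) \<le> B1" using B1[OF ac, of "b - a"] nba r_ge by simp
      moreover have "P \<bullet> (b - a - Q) \<le> norm P * norm (b - a - Q)" by (rule norm_cauchy_schwarz)
      moreover have "\<dots> \<le> C1 * (?n + norm Q)"
        using P C1_nonneg nba norm_triangle_ineq4[of "b - a" Q] by (intro mult_mono) auto
      ultimately show ?thesis using \<epsilon> unfolding C2_def by linarith
    qed
    define g where "g v = L (abs_torus a) v + P \<bullet> (v - Q)" for v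
    have contg: "continuous_on S g" for S
    proof -
      have "continuous_on UNIV (\<lambda>v. (\<lambda>(x, v). L (abs_torus x) v) (a, v))"
        by (intro continuous_on_compose2[OF cont] continuous_intros) auto
      then have "continuous_on UNIV g" unfolding g_def by (auto intro!: continuous_intros)
      then show ?thesis by (rule continuous_on_subset) simp
    qed
    have "uniformly_continuous_on (cball 0 (R + 1)) g"
      using contg by (intro compact_uniformly_continuous) auto
    then obtain \<delta>' where \<delta>': "\<delta>' > 0" "\<And>v w. norm v \<le> R + 1 \<Longrightarrow> norm w \<le> R + 1 \<Longrightarrow> dist v w < \<delta>' \<Longrightarrow> dist (g v) (g w) < \<epsilon> / 2"
      unfolding uniformly_continuous_on_def using \<epsilon> by (metis half_gt_zero mem_cball_0)
    define \<delta> where "\<delta> = min 1 \<delta>'"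
    have \<delta>: "\<delta> > 0" "\<delta> \<le> 1" "\<delta> \<le> \<delta>'" using \<delta>' by (auto simp: \<delta>_def)
    have "bounded (g ` cball 0 (R + 1))"
      by (intro compact_imp_bounded compact_continuous_image contg compact_cball)
    then obtain G where G: "\<And>v. norm v \<le> R + 1 \<Longrightarrow> \<bar>g v\<bar> \<le> G" unfolding bounded_iff by fastforce
    \<comment> \<open>At distance \<open>\<delta>\<close> from a well, the slope \<open>K\<close> makes up for the lower bounds \<open>- G\<close> of \<open>g\<close>
      and \<open>- C2\<close> of \<open>u b - u a\<close>.\<close>
    define K where "K = \<bar>V + \<epsilon> + G + C2\<bar> / \<delta>"
    have K: "K \<ge> 0" "K * \<delta> \<ge> V + \<epsilon> + G + C2" using \<delta> by (auto simp: K_def)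
    obtain U where U: "continuous_on UNIV U"
      "\<And>y. U (abs_torus y) = Min ((\<lambda>b. u b + K * infdist y ((+) b ` lattice_vectors)) ` F)"
      using continuous_on_torus_wells[of F u K] F a by blast
    have Ua: "U (abs_torus a) \<le> u a"
    proof -
      have "U (abs_torus a) \<le> u a + K * infdist a ((+) a ` lattice_vectors)"
        unfolding U(2) using F a by (intro Min_le finite_imageI image_eqI[OF refl]) auto
      moreover have "a \<in> (+) a ` lattice_vectors" using lattice_zero by force
      ultimately show ?thesis by simp
    qed
    have main: "V + \<epsilon> / 2 \<le> L (abs_torus a) v + U (abs_torus a +\<^sub>T v) - U (abs_torus a) + P \<bullet> (v - Q)" for v
    proof -
      have "\<exists>b\<in>F. U (abs_torus (a + v)) = u b + K * infdist (a + v) ((+) b ` lattice_vectors)"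
      proof -
        have "U (abs_torus (a + v)) \<in> (\<lambda>b. u b + K * infdist (a + v) ((+) b ` lattice_vectors)) ` F"
          unfolding U(2) using F a by (intro Min_in) auto
        then show ?thesis by blast
      qed
      then obtain b where b: "b \<in> F" "U (abs_torus (a + v)) = u b + K * infdist (a + v) ((+) b ` lattice_vectors)"
        by blast
      have "V + \<epsilon> / 2 \<le> g v + U (abs_torus (a + v)) - u a"
      proof (cases "norm v \<ge> R")
        case True
        have "P \<bullet> (v - Q) \<ge> - (norm P * norm (v - Q))"
          using Cauchy_Schwarz_ineq2[of P "v - Q"] by linarith
        moreover have "norm P * norm (v - Q) \<le> C1 * (norm v + norm Q)"
          using P C1_nonneg norm_triangle_ineq4[of v Q] by (intro mult_mono) auto
        ultimately have "g v \<ge> norm v - B2 - C1 * norm Q"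
          using B2[of v "abs_torus a"] unfolding g_def by (simp add: algebra_simps)
        moreover have "U (abs_torus (a + v)) \<ge> u b" using b K by (simp add: infdist_nonneg)
        moreover have "norm v \<ge> V + \<epsilon> + B2 + C2 + C1 * norm Q" using True by (simp add: R_def)
        ultimately show ?thesis using ub[OF b(1)] \<epsilon> by linarith
      next
        case False
        show ?thesis
        proof (cases "infdist (a + v) ((+) b ` lattice_vectors) \<ge> \<delta>")
          case True
          then have "K * infdist (a + v) ((+) b ` lattice_vectors) \<ge> K * \<delta>" using K by (intro mult_left_mono)
          moreover have "g v \<ge> - G" using G[of v] False by auto
          ultimately show ?thesis using K ub[OF b(1)] b(2) \<epsilon> by linarith
        next
          case far: False
          have "lattice_vectors \<noteq> ({} :: (real ^ 'n) set)" using lattice_zero by blast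
          then obtain z where z: "z \<in> lattice_vectors" "dist (a + v) (b + z) < \<delta>"
            using far by (auto simp: infdist_def cINF_less_iff not_le)
          let ?w = "b - a + z"
          have d: "dist v ?w < \<delta>" using z(2) by (simp add: dist_norm algebra_simps)
          have w: "norm ?w \<le> R + 1"
            using d \<delta> False norm_triangle_ineq3[of ?w v] by (simp add: dist_norm norm_minus_commute)
          have "norm z \<le> norm ?w + norm (b - a)" using norm_triangle_ineq4[of ?w "b - a"] by simp
          then have "norm z \<le> \<rho>" using w norm_diff_torus_cube[OF ac, of b] F b by (auto simp: \<rho>_def)
          then have "V + \<epsilon> < g ?w + u b - u a" using gt[OF b(1) z(1)] by (simp add: g_def algebra_simps)
          moreover have "g ?w - g v < \<epsilon> / 2"
            using \<delta>'(2)[of v ?w] w d \<delta> False unfolding dist_real_def abs_less_iff by auto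
          moreover have "U (abs_torus (a + v)) \<ge> u b" using b K by (simp add: infdist_nonneg)
          moreover have "V + \<epsilon> / 2 = (V + \<epsilon>) - \<epsilon> / 2" by simp
          ultimately show ?thesis by linarith
        qed
      qed
      then show ?thesis using Ua by (simp add: abs_torus_add g_def)
    qed
    have "ereal (V + \<epsilon> / 2) \<le> (INF v. ereal (L (abs_torus a) v + U (abs_torus a +\<^sub>T v) - U (abs_torus a) + P \<bullet> (v - Q)))"
      by (rule INF_greatest) (simp only: ereal_less_eq(3) main)
    also have "\<dots> \<le> ereal V" using val[OF U(1), where x = "abs_torus a" and P = P] .
    finally show False using \<epsilon> by simp
  qed
  show ?thesis by (rule that, rule claim)
qed

section \<open>Extended integrals and plan measures\<close>

lemma ext_integral_integrable:
  fixes f :: "'a \<Rightarrow> real"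
  assumes "integrable M f"
  shows "ext_integral M (\<lambda>z. ereal (f z)) = ereal (\<integral>z. f z \<partial>M)"
proof -
  have "enn2ereal x = ereal (enn2real x)" if "x \<noteq> \<infinity>" for x
    using that by (cases x) (simp_all add: enn2ereal_ennreal)
  then show ?thesis
    using assms by (simp add: ext_integral_def real_integrable_def real_lebesgue_integral_def)
qed

lemma ext_integral_not_integrable:
  fixes f :: "'a \<Rightarrow> real"
  assumes "finite_measure M" "f \<in> borel_measurable M" "\<And>z. f z \<ge> - C" "\<not> integrable M f"
  shows "ext_integral M (\<lambda>z. ereal (f z)) = \<infinity>"
proof -
  interpret finite_measure M by fact
  have "(\<integral>\<^sup>+z. ennreal (- f z) \<partial>M) \<le> (\<integral>\<^sup>+z. ennreal C \<partial>M)"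
    using assms(3) by (intro nn_integral_mono ennreal_leI) (simp add: minus_le_iff)
  also have "\<dots> < \<infinity>" by (simp add: ennreal_mult_less_top emeasure_eq_measure)
  finally have neg: "(\<integral>\<^sup>+z. ennreal (- f z) \<partial>M) \<noteq> \<infinity>" by simp
  then have "(\<integral>\<^sup>+z. ennreal (f z) \<partial>M) = \<infinity>"
    using assms(2,4) by (auto simp: real_integrable_def)
  moreover have "enn2ereal x \<noteq> \<infinity>" if "x \<noteq> \<infinity>" for x
    using that by (cases x) (simp_all add: enn2ereal_ennreal)
  ultimately show ?thesis
    using neg by (simp add: ext_integral_def)
qed

lemma lagrangian_measurable:
  fixes L :: "'n::finite torus \<Rightarrow> real ^ 'n \<Rightarrow> real"
  assumes "continuous_on UNIV (\<lambda>(x, v). L (abs_torus x) v)"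
  shows "(\<lambda>(x, v). L x v) \<in> borel_measurable (borel \<Otimes>\<^sub>M borel)"
proof -
  have "(\<lambda>(y, v). L (abs_torus y) v) \<in> borel_measurable (borel \<Otimes>\<^sub>M borel)"
    unfolding borel_prod using assms by (rule borel_measurable_continuous_onI)
  moreover have "(\<lambda>z. (torus_rep (fst z), snd z)) \<in> borel \<Otimes>\<^sub>M borel \<rightarrow>\<^sub>M borel \<Otimes>\<^sub>M borel"
    by measurable
  ultimately show ?thesis
    by (rule measurable_compose[rotated, THEN measurable_cong[THEN iffD1, rotated]]) auto
qed

lemma torus_shift_measurable:
  fixes u :: "'n::finite torus \<Rightarrow> real"
  assumes "continuous_on UNIV u"
  shows "(\<lambda>(x, v). u (x +\<^sub>T v)) \<in> borel_measurable (borel \<Otimes>\<^sub>M borel)"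
proof -
  have "continuous_on UNIV (\<lambda>y. u (abs_torus y))" using assms by (simp add: continuous_on_torus_iff)
  then have "continuous_on UNIV (\<lambda>(y, v). u (abs_torus y +\<^sub>T v))"
    by (auto simp: abs_torus_add split_beta intro!: continuous_intros elim: continuous_on_compose2)
  then show ?thesis by (rule lagrangian_measurable)
qed

text \<open>What is said here about \<open>\<pi>(x, dv) \<theta>(dx)\<close> only uses that \<open>\<pi>\<close> is a probability kernel, so
  that it serves for given plans as well as in the proof that a constructed kernel is a plan.\<close>

locale kernel_plan =
  fixes \<theta> :: "'n::finite torus measure" and \<pi> :: "'n torus \<Rightarrow> (real ^ 'n) measure"
  assumes \<theta>: "\<theta> \<in> space (prob_algebra borel)" and \<pi>: "\<pi> \<in> borel \<rightarrow>\<^sub>M prob_algebra borel"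
begin

lemma prob_space_theta: "prob_space \<theta>" and sets_theta [measurable_cong]: "sets \<theta> = sets borel"
  using \<theta> by (auto simp: space_prob_algebra)

lemma space_theta: "space \<theta> = UNIV"
  using sets_eq_imp_space_eq[OF sets_theta] by simp

lemma prob_space_kernel: "prob_space (\<pi> x)" and sets_kernel [measurable_cong]: "sets (\<pi> x) = sets borel"
  using measurable_space[OF \<pi>, of x] by (auto simp: space_prob_algebra)

lemma kernel_Pair_measurable:
  "(\<lambda>x. distr (\<pi> x) (borel \<Otimes>\<^sub>M borel) (Pair x)) \<in> \<theta> \<rightarrow>\<^sub>M subprob_algebra (borel \<Otimes>\<^sub>M borel)"
proof -
  have "\<pi> \<in> \<theta> \<rightarrow>\<^sub>M subprob_algebra borel"
    using measurable_prob_algebraD[OF \<pi>] by (simp cong: measurable_cong_sets add: sets_theta)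
  then show ?thesis
    by (rule measurable_distr2[rotated]) (simp add: split_beta)
qed

lemma sets_plan_measure [measurable_cong]: "sets (plan_measure \<theta> \<pi>) = sets (borel \<Otimes>\<^sub>M borel)"
  unfolding plan_measure_def
  by (rule sets_bind) (simp_all add: space_theta)

lemma nn_integral_plan_measure:
  assumes [measurable]: "f \<in> borel_measurable (borel \<Otimes>\<^sub>M borel)"
  shows "(\<integral>\<^sup>+z. f z \<partial>plan_measure \<theta> \<pi>) = (\<integral>\<^sup>+x. \<integral>\<^sup>+v. f (x, v) \<partial>\<pi> x \<partial>\<theta>)"
  unfolding plan_measure_def
  by (subst nn_integral_bind[OF assms kernel_Pair_measurable])
    (auto intro!: nn_integral_cong nn_integral_distr)

lemma prob_space_plan_measure: "prob_space (plan_measure \<theta> \<pi>)"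
proof
  have "emeasure (plan_measure \<theta> \<pi>) (space (plan_measure \<theta> \<pi>)) = (\<integral>\<^sup>+z. 1 \<partial>plan_measure \<theta> \<pi>)" by simp
  also have "\<dots> = (\<integral>\<^sup>+x. \<integral>\<^sup>+v. 1 \<partial>\<pi> x \<partial>\<theta>)" by (rule nn_integral_plan_measure) simp
  also have "\<dots> = 1"
    using prob_space.emeasure_space_1[OF prob_space_kernel] prob_space.emeasure_space_1[OF prob_space_theta]
    by simp
  finally show "emeasure (plan_measure \<theta> \<pi>) (space (plan_measure \<theta> \<pi>)) = 1" .
qed

lemma distr_plan_measure_fst: "distr (plan_measure \<theta> \<pi>) borel fst = \<theta>"
proof (rule measure_eqI)
  fix A assume "A \<in> sets (distr (plan_measure \<theta> \<pi>) borel fst)"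
  then have A [measurable]: "A \<in> sets borel" by simp
  have "emeasure (distr (plan_measure \<theta> \<pi>) borel fst) A = (\<integral>\<^sup>+x. indicator A x \<partial>distr (plan_measure \<theta> \<pi>) borel fst)"
    by simp
  also have "\<dots> = (\<integral>\<^sup>+z. indicator A (fst z) \<partial>plan_measure \<theta> \<pi>)"
    by (rule nn_integral_distr) auto
  also have "\<dots> = (\<integral>\<^sup>+x. \<integral>\<^sup>+v. indicator A (fst (x, v)) \<partial>\<pi> x \<partial>\<theta>)"
    by (rule nn_integral_plan_measure) measurable
  also have "\<dots> = (\<integral>\<^sup>+x. indicator A x \<partial>\<theta>)"
    using prob_space.emeasure_space_1[OF prob_space_kernel] by simp
  also have "\<dots> = emeasure \<theta> A" by (simp add: sets_theta)
  finally show "emeasure (distr (plan_measure \<theta> \<pi>) borel fst) A = emeasure \<theta> A" .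
qed (simp add: sets_theta)

end

section \<open>Weak duality\<close>

text \<open>The infimum of a family of continuous functions is upper semicontinuous.\<close>

lemma dual_integrand_measurable:
  fixes L :: "'n::finite torus \<Rightarrow> real ^ 'n \<Rightarrow> real"
  assumes cont: "continuous_on UNIV (\<lambda>(x, v). L (abs_torus x) v)" and u: "continuous_on UNIV u"
  shows "(\<lambda>x. INF v. ereal (L x v + u (x +\<^sub>T v) - u x + P \<bullet> (v - Q))) \<in> borel_measurable borel"
proof (rule borel_measurableI_less)
  fix c :: ereal
  have ua: "continuous_on UNIV (\<lambda>y. u (abs_torus y))" using u by (simp add: continuous_on_torus_iff)
  have "continuous_on UNIV (\<lambda>y. (\<lambda>(x, v). L (abs_torus x) v) (y, v))" for v
    by (intro continuous_on_compose2[OF cont] continuous_intros) auto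
  then have La: "continuous_on UNIV (\<lambda>y. L (abs_torus y) v)" for v by simp
  have "continuous_on UNIV (\<lambda>x. L x v + u (x +\<^sub>T v) - u x + P \<bullet> (v - Q))" for v
    unfolding continuous_on_torus_iff abs_torus_add
    by (intro continuous_intros La ua continuous_on_compose2[OF ua]) auto
  then have "continuous_on UNIV (\<lambda>x. ereal (L x v + u (x +\<^sub>T v) - u x + P \<bullet> (v - Q)))" for v
    by (intro continuous_on_ereal)
  then have "open ((\<lambda>x. ereal (L x v + u (x +\<^sub>T v) - u x + P \<bullet> (v - Q))) -` {..<c})" for v
    by (intro open_vimage) auto
  moreover have "{x \<in> space borel. (INF v. ereal (L x v + u (x +\<^sub>T v) - u x + P \<bullet> (v - Q))) < c} =
      (\<Union>v. (\<lambda>x. ereal (L x v + u (x +\<^sub>T v) - u x + P \<bullet> (v - Q))) -` {..<c})"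
    by (auto simp: INF_less_iff)
  ultimately show "{x \<in> space borel. (INF v. ereal (L x v + u (x +\<^sub>T v) - u x + P \<bullet> (v - Q))) < c} \<in> sets borel"
    by (simp only:) (intro borel_open open_UN, auto)
qed

lemma torus_add_zero [simp]: "x +\<^sub>T 0 = x"
  by transfer simp

lemma dual_integrand_bounded:
  fixes L :: "'n::finite torus \<Rightarrow> real ^ 'n \<Rightarrow> real"
  assumes cont: "continuous_on UNIV (\<lambda>(x, v). L (abs_torus x) v)"
    and superlinear: "\<And>A. \<exists>B. \<forall>x v. L x v \<ge> A * norm v - B"
    and u: "continuous_on UNIV u"
  obtains m D where "m \<in> borel_measurable borel" "\<And>x. \<bar>m x\<bar> \<le> D"
    "\<And>x. (INF v. ereal (L x v + u (x +\<^sub>T v) - u x + P \<bullet> (v - Q))) = ereal (m x)"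
    "\<And>x v. m x \<le> L x v + u (x +\<^sub>T v) - u x + P \<bullet> (v - Q)"
proof -
  let ?l = "\<lambda>x v. L x v + u (x +\<^sub>T v) - u x + P \<bullet> (v - Q)"
  let ?m = "\<lambda>x. INF v. ereal (?l x v)"
  obtain Bu where Bu: "\<And>x. \<bar>u x\<bar> \<le> Bu" using continuous_torus_bounded[OF u] by blast
  have "continuous_on UNIV (\<lambda>y. (\<lambda>(x, v). L (abs_torus x) v) (y, 0))"
    by (intro continuous_on_compose2[OF cont] continuous_intros) auto
  then have "continuous_on UNIV (\<lambda>x. L x 0)" by (simp add: continuous_on_torus_iff)
  then obtain B0 where B0: "\<And>x. \<bar>L x 0\<bar> \<le> B0" using continuous_torus_bounded by blast
  obtain B where B: "\<And>x v. L x v \<ge> norm P * norm v - B" using superlinear by blast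
  define D where "D = \<bar>B\<bar> + 2 * Bu + norm P * norm Q + B0"
  have PQ: "\<bar>P \<bullet> Q\<bar> \<le> norm P * norm Q" by (rule Cauchy_Schwarz_ineq2)
  have nn: "Bu \<ge> 0" "B0 \<ge> 0" using Bu B0 abs_ge_zero order_trans by blast+
  have lower: "- D \<le> ?l x v" for x v
  proof -
    have "\<bar>P \<bullet> v\<bar> \<le> norm P * norm v" by (rule Cauchy_Schwarz_ineq2)
    then show ?thesis
      using B[where x = x and v = v] Bu[of x] Bu[of "x +\<^sub>T v"] PQ nn
      unfolding D_def inner_diff_right by linarith
  qed
  have lowm: "ereal (- D) \<le> ?m x" for x using lower by (intro INF_greatest) simp
  have "?m x \<le> ereal (?l x 0)" for x by (rule INF_lower) simp
  moreover have "?l x 0 \<le> D" for x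
    using B0[of x] PQ nn unfolding D_def inner_diff_right torus_add_zero by simp
  ultimately have upm: "?m x \<le> ereal D" for x by (meson ereal_less_eq(3) order_trans)
  have eq: "?m x = ereal (real_of_ereal (?m x))" for x
    using lowm[of x] upm[of x] by (cases "?m x") auto
  have "\<bar>real_of_ereal (?m x)\<bar> \<le> D" for x
    using lowm[of x] upm[of x] by (cases "?m x") auto
  moreover have "(\<lambda>x. real_of_ereal (?m x)) \<in> borel_measurable borel"
    using dual_integrand_measurable[OF cont u] by measurable
  moreover have "real_of_ereal (?m x) \<le> ?l x v" for x v
  proof -
    have "?m x \<le> ereal (?l x v)" by (rule INF_lower) simp
    then show ?thesis by (subst (asm) eq) simp
  qed
  ultimately show ?thesis using that[of "\<lambda>x. real_of_ereal (?m x)" D] eq by blast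
qed

text \<open>A plan with \<open>L\<close> not integrable has infinite cost. Otherwise the infimum over \<open>v\<close> is at most
  the bracket at the \<open>v\<close> chosen by the plan, and in the mean the bracket reduces to \<open>L\<close>.\<close>

lemma dual_value_le_plan_cost:
  fixes L :: "'n::finite torus \<Rightarrow> real ^ 'n \<Rightarrow> real"
  assumes cont: "continuous_on UNIV (\<lambda>(x, v). L (abs_torus x) v)"
    and superlinear: "\<And>A. \<exists>B. \<forall>x v. L x v \<ge> A * norm v - B"
    and \<theta>: "\<theta> \<in> space (prob_algebra borel)" and plan: "\<pi> \<in> plans \<theta> Q"
    and u: "continuous_on UNIV u"
  shows "ext_integral \<theta> (\<lambda>x. INF v. ereal (L x v + u (x +\<^sub>T v) - u x + P \<bullet> (v - Q)))
    \<le> ext_integral (plan_measure \<theta> \<pi>) (\<lambda>(x, v). ereal (L x v))"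
proof -
  interpret kernel_plan \<theta> \<pi> using \<theta> plan by unfold_locales (auto simp: plans_def)
  let ?p = "plan_measure \<theta> \<pi>"
  interpret p: prob_space ?p by (rule prob_space_plan_measure)
  interpret t: prob_space \<theta> by (rule prob_space_theta)
  obtain m D where m: "m \<in> borel_measurable borel" "\<And>x. \<bar>m x\<bar> \<le> D"
    "\<And>x. (INF v. ereal (L x v + u (x +\<^sub>T v) - u x + P \<bullet> (v - Q))) = ereal (m x)"
    "\<And>x v. m x \<le> L x v + u (x +\<^sub>T v) - u x + P \<bullet> (v - Q)"
    using dual_integrand_bounded[OF cont superlinear u] by blast
  note [measurable] = m(1) lagrangian_measurable[OF cont] torus_shift_measurable[OF u]
  have L_eq: "(\<lambda>(x, v). ereal (L x v)) = (\<lambda>z. ereal ((\<lambda>(x, v). L x v) z))" by auto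
  have u_meas [measurable]: "u \<in> borel_measurable borel" using u by (rule borel_measurable_continuous_onI)
  show ?thesis
  proof (cases "integrable ?p (\<lambda>(x, v). L x v)")
    case False
    obtain B where "\<And>x v. L x v \<ge> 0 * norm v - B" using superlinear by blast
    then have "ext_integral ?p (\<lambda>(x, v). ereal (L x v)) = \<infinity>"
      unfolding L_eq using False
      by (intro ext_integral_not_integrable[where C = B] p.finite_measure_axioms) auto
    then show ?thesis by simp
  next
    case True
    obtain Bu where Bu: "\<And>x. \<bar>u x\<bar> \<le> Bu" using continuous_torus_bounded[OF u] by blast
    have i1: "integrable ?p (\<lambda>(x, v). u (x +\<^sub>T v))"
      by (rule p.integrable_const_bound[where B = Bu]) (auto simp: Bu)
    have i2: "integrable ?p (\<lambda>z. u (fst z))"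
      by (rule p.integrable_const_bound[where B = Bu]) (auto simp: Bu)
    have i3: "integrable ?p (\<lambda>(x, v). v)" using plan by (simp add: plans_def)
    have i4: "integrable ?p (\<lambda>z. m (fst z))"
      by (rule p.integrable_const_bound[where B = D]) (auto simp: m)
    have i5: "integrable \<theta> m"
      by (rule t.integrable_const_bound[where B = D]) (auto simp: m)
    have marg: "(\<integral>z. f (fst z) \<partial>?p) = (\<integral>x. f x \<partial>\<theta>)" if [measurable]: "f \<in> borel_measurable borel" for f :: "_ \<Rightarrow> real"
      using integral_distr[of fst ?p borel f] by (simp add: distr_plan_measure_fst)
    have e1: "(\<integral>(x, v). u (x +\<^sub>T v) \<partial>?p) = (\<integral>x. u x \<partial>\<theta>)" using plan u by (simp add: plans_def)
    have e3: "(\<integral>(x, v). v \<partial>?p) = Q" using plan by (simp add: plans_def)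
    have i6: "integrable ?p (\<lambda>z. P \<bullet> ((\<lambda>(x, v). v) z - Q))"
      using i3 by (intro integrable_inner_right Bochner_Integration.integrable_diff) auto
    have e6: "(\<integral>z. P \<bullet> ((\<lambda>(x, v). v) z - Q) \<partial>?p) = 0"
      using i3 e3 by (simp add: p.prob_space)
    have "(\<integral>x. m x \<partial>\<theta>) = (\<integral>z. m (fst z) \<partial>?p)" by (simp add: marg)
    also have "\<dots> \<le> (\<integral>z. (\<lambda>(x, v). L x v) z + (\<lambda>(x, v). u (x +\<^sub>T v)) z - u (fst z) + P \<bullet> ((\<lambda>(x, v). v) z - Q) \<partial>?p)"
      using m(4)
      by (intro integral_mono i4 Bochner_Integration.integrable_add Bochner_Integration.integrable_diff
          True i1 i2 i6) auto
    also have "\<dots> = (\<integral>z. (\<lambda>(x, v). L x v) z \<partial>?p) + (\<integral>(x, v). u (x +\<^sub>T v) \<partial>?p) - (\<integral>z. u (fst z) \<partial>?p) + 0"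
      by (simp only: Bochner_Integration.integral_add Bochner_Integration.integral_diff
          Bochner_Integration.integrable_add Bochner_Integration.integrable_diff True i1 i2 i6 e6)
    also have "\<dots> = (\<integral>z. (\<lambda>(x, v). L x v) z \<partial>?p)" by (simp add: e1 marg)
    finally show ?thesis
      unfolding L_eq m(3) ext_integral_integrable[OF True] ext_integral_integrable[OF i5] by simp
  qed
qed

section \<open>Cutting the torus into cells\<close>

text \<open>Coordinates are rounded down to multiples of \<open>1 / N\<close>. Points whose cell is a null set are
  reassigned to one of the cells of positive mass, so that conditioning on a cell is always
  possible; this spoils the approximation on a null set only.\<close>

lemma torus_simple_approximation:
  fixes \<theta> :: "'n::finite torus measure"
  assumes \<theta>: "\<theta> \<in> space (prob_algebra borel)" and \<delta>: "\<delta> > 0"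
  obtains c F where "finite F" "F \<subseteq> torus_cube" "c \<in> borel \<rightarrow>\<^sub>M count_space F"
    "\<And>a. a \<in> F \<Longrightarrow> measure \<theta> (c -` {a}) > 0" "AE x in \<theta>. norm (torus_rep x - c x) \<le> \<delta>"
proof -
  interpret prob_space \<theta> using \<theta> by (simp add: space_prob_algebra)
  have sets_theta [measurable_cong]: "sets \<theta> = sets borel" using \<theta> by (simp add: space_prob_algebra)
  obtain N :: nat where N: "real N > CARD('n) / \<delta>" using reals_Archimedean2 by blast
  have N0: "real N > 0" using N \<delta> by (smt (verit) divide_nonneg_pos of_nat_0_le_iff)
  define c0 :: "'n torus \<Rightarrow> real ^ 'n" where "c0 x = (\<chi> i. of_int \<lfloor>real N * torus_rep x $ i\<rfloor> / real N)" for x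
  have c0_near: "c0 x $ i \<le> torus_rep x $ i" "torus_rep x $ i \<le> c0 x $ i + 1 / real N" for x i
    using N0 by (simp_all add: c0_def field_simps, linarith+)
  have rep: "0 \<le> torus_rep x $ i" "torus_rep x $ i \<le> 1" for x :: "'n torus" and i
    using torus_rep_in_cube[of x] by (auto simp: torus_cube_iff)
  have near: "norm (torus_rep x - c0 x) \<le> \<delta>" for x :: "'n torus"
  proof -
    have "\<bar>(torus_rep x - c0 x) $ i\<bar> \<le> 1 / real N" for i using c0_near[of x i] by (simp add: abs_le_iff)
    then have "norm (torus_rep x - c0 x) \<le> CARD('n) * (1 / real N)" by (rule norm_le_coordinate_bound)
    also have "\<dots> \<le> \<delta>" using N N0 \<delta> by (simp add: field_simps)
    finally show ?thesis .
  qed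
  have k_range: "\<lfloor>real N * torus_rep x $ i\<rfloor> \<in> {0..int N}" for x :: "'n torus" and i
  proof -
    have "real N * torus_rep x $ i \<le> real N * 1" using rep[of x i] N0 by (intro mult_left_mono) auto
    moreover have "0 \<le> real N * torus_rep x $ i" using rep[of x i] by simp
    ultimately show ?thesis by (simp add: floor_le_iff le_floor_iff)
  qed
  define F0 where "F0 = range c0"
  have "F0 \<subseteq> {y. \<forall>i. y $ i \<in> (\<lambda>k. of_int k / real N) ` {0..int N}}"
    unfolding F0_def using k_range by (auto simp: c0_def)
  then have finF0: "finite F0" by (rule finite_subset) (intro finite_vectors_if_finite_coordinates finite_imageI finite_atLeastAtMost_int)
  have F0_cube: "F0 \<subseteq> torus_cube"
  proof -
    have "c0 x \<in> torus_cube" for x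
      unfolding torus_cube_iff
    proof (intro allI conjI)
      fix i
      show "0 \<le> c0 x $ i" using k_range[of x i] by (simp add: c0_def)
      show "c0 x $ i \<le> 1" using c0_near(1)[of x i] rep(2)[of x i] by linarith
    qed
    then show ?thesis by (auto simp: F0_def)
  qed
  have coord: "(\<lambda>x :: 'n torus. torus_rep x $ i) \<in> borel_measurable borel" for i
  proof -
    have "(\<lambda>y :: real ^ 'n. y $ i) \<in> borel_measurable borel"
      by (intro borel_measurable_continuous_onI continuous_intros)
    from measurable_compose[OF torus_rep_measurable this] show ?thesis .
  qed
  have c0_meas: "c0 -` {a} \<in> sets borel" for a
  proof -
    have "c0 -` {a} = (\<Inter>i. {x \<in> space borel. of_int \<lfloor>real N * torus_rep x $ i\<rfloor> / real N = a $ i})"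
      by (auto simp: c0_def vec_eq_iff)
    also have "\<dots> \<in> sets borel"
      using coord by (intro sets.finite_INT) (auto, measurable)
    finally show ?thesis .
  qed
  define F where "F = {a \<in> F0. measure \<theta> (c0 -` {a}) > 0}"
  have finF: "finite F" using finF0 by (simp add: F_def)
  have AE_F: "AE x in \<theta>. c0 x \<in> F"
  proof -
    have "AE x in \<theta>. \<not> (c0 x = a)" if "a \<in> F0 - F" for a
    proof (rule AE_I')
      have "measure \<theta> (c0 -` {a}) = 0"
        using that measure_nonneg[of \<theta> "c0 -` {a}"] by (auto simp: F_def not_less)
      then show "c0 -` {a} \<in> null_sets \<theta>"
        using c0_meas by (simp add: null_sets_def emeasure_eq_measure sets_theta)
      show "{x \<in> space \<theta>. \<not> \<not> c0 x = a} \<subseteq> c0 -` {a}" by auto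
    qed
    then have "AE x in \<theta>. \<forall>a\<in>F0 - F. c0 x \<noteq> a"
      using finF0 by (intro AE_finite_allI) auto
    then show ?thesis by eventually_elim (auto simp: F0_def)
  qed
  have "F \<noteq> {}"
  proof
    assume "F = {}"
    then have "AE x in \<theta>. False" using AE_F by simp
    then show False by simp
  qed
  then obtain a0 where a0: "a0 \<in> F" by blast
  define c where "c x = (if c0 x \<in> F then c0 x else a0)" for x
  have c_vimage: "c -` {a} = (if a = a0 then c0 -` {a} \<union> (UNIV - (\<Union>b\<in>F. c0 -` {b})) else c0 -` {a})" if "a \<in> F" for a
    using that a0 by (auto simp: c_def)
  have "c -` {a} \<in> sets borel" if "a \<in> F" for a
    unfolding c_vimage[OF that] using c0_meas finF
    by (auto intro!: sets.Un sets.Diff sets.finite_UN simp del: vimage_eq)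
  then have c_meas: "c \<in> borel \<rightarrow>\<^sub>M count_space F"
    using finF a0 by (auto simp: measurable_count_space_eq2 c_def)
  have pos: "measure \<theta> (c -` {a}) > 0" if "a \<in> F" for a
  proof -
    have "measure \<theta> (c0 -` {a}) \<le> measure \<theta> (c -` {a})"
      using that c_meas finF by (intro finite_measure_mono)
        (auto simp: measurable_count_space_eq2 sets_theta c_def)
    then show ?thesis using that by (simp add: F_def)
  qed
  have "AE x in \<theta>. norm (torus_rep x - c x) \<le> \<delta>"
    using AE_F by eventually_elim (simp add: c_def near)
  moreover have "F \<subseteq> torus_cube" using F0_cube by (auto simp: F_def)
  ultimately show ?thesis using that[of F c] finF c_meas pos by blast
qed

section \<open>Spreading a discrete plan over the cells\<close>

text \<open>The map \<open>c\<close> sends a point to the representative of its cell, and \<open>w\<close> gives the masses of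
  the cells. The weight \<open>q(a, b, z)\<close> is the mass that moves from the cell of \<open>a\<close> to the cell
  of \<open>b\<close>, wrapping around the torus by the integer vector \<open>z\<close>.\<close>

locale coupled_cells =
  fixes \<theta> :: "'n::finite torus measure" and c :: "'n torus \<Rightarrow> real ^ 'n"
    and F Z :: "(real ^ 'n) set"
    and q :: "(real ^ 'n) \<times> (real ^ 'n) \<times> (real ^ 'n) \<Rightarrow> real" and w :: "real ^ 'n \<Rightarrow> real"
  assumes \<theta>: "\<theta> \<in> space (prob_algebra borel)"
    and finite_F: "finite F" and c_measurable: "c \<in> borel \<rightarrow>\<^sub>M count_space F"
    and w_def: "\<And>a. w a = measure \<theta> (c -` {a})" and w_pos: "\<And>a. a \<in> F \<Longrightarrow> w a > 0"
    and finite_Z: "finite Z" and Z_lattice: "Z \<subseteq> lattice_vectors"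
    and q_nonneg: "\<And>m. q m \<ge> 0"
    and q_row: "\<And>a. a \<in> F \<Longrightarrow> (\<Sum>z\<in>Z. \<Sum>b\<in>F. q (a, b, z)) = w a"
    and q_col: "\<And>b. b \<in> F \<Longrightarrow> (\<Sum>z\<in>Z. \<Sum>a\<in>F. q (a, b, z)) = w b"
begin

sublocale theta: prob_space \<theta>
  using \<theta> by (simp add: space_prob_algebra)

lemma sets_theta [measurable_cong]: "sets \<theta> = sets borel"
  using \<theta> by (simp add: space_prob_algebra)

lemma space_theta [simp]: "space \<theta> = UNIV"
  using sets_eq_imp_space_eq[OF sets_theta] by simp

lemma c_in_F [simp]: "c x \<in> F"
  using measurable_space[OF c_measurable, of x] by simp

lemma emeasure_cell: "emeasure \<theta> (c -` {a}) = ennreal (w a)"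
  by (simp add: w_def theta.emeasure_eq_measure)

lemma cell_sets: "a \<in> F \<Longrightarrow> c -` {a} \<in> sets \<theta>"
  using c_measurable finite_F by (simp add: measurable_count_space_eq2 sets_theta)

lemma nn_integral_cells:
  fixes G :: "real ^ 'n \<Rightarrow> ennreal"
  shows "(\<integral>\<^sup>+y. G (c y) \<partial>\<theta>) = (\<Sum>b\<in>F. ennreal (w b) * G b)"
proof -
  have "G (c y) = (\<Sum>b\<in>F. G b * indicator (c -` {b}) y)" for y
  proof -
    have "(\<Sum>b\<in>F. G b * indicator (c -` {b}) y) = (\<Sum>b\<in>F. if b = c y then G b else 0)"
      by (intro sum.cong) (auto simp: indicator_def)
    then show ?thesis using finite_F by simp
  qed
  then have "(\<integral>\<^sup>+y. G (c y) \<partial>\<theta>) = (\<integral>\<^sup>+y. (\<Sum>b\<in>F. G b * indicator (c -` {b}) y) \<partial>\<theta>)" by simp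
  also have "\<dots> = (\<Sum>b\<in>F. \<integral>\<^sup>+y. G b * indicator (c -` {b}) y \<partial>\<theta>)"
    using cell_sets by (intro nn_integral_sum) auto
  also have "\<dots> = (\<Sum>b\<in>F. ennreal (w b) * G b)"
    using cell_sets by (intro sum.cong) (simp_all add: nn_integral_cmult_indicator emeasure_cell mult.commute)
  finally show ?thesis .
qed

definition targets :: "('n torus \<times> (real ^ 'n)) measure" where
  "targets = \<theta> \<Otimes>\<^sub>M count_space Z"

text \<open>From \<open>x\<close> the plan chooses a landing point \<open>y\<close> and a shift \<open>z\<close>. Relative to the product of
  \<open>\<theta>\<close> and the counting measure, their density is constant on products of cells, which is to
  say that \<open>y\<close> is distributed like \<open>\<theta>\<close> conditioned on its cell.\<close>

definition rate :: "'n torus \<Rightarrow> 'n torus \<times> (real ^ 'n) \<Rightarrow> ennreal" where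
  "rate x t = ennreal (q (c x, c (fst t), snd t) / (w (c x) * w (c (fst t))))"

definition jump :: "'n torus \<Rightarrow> 'n torus \<times> (real ^ 'n) \<Rightarrow> real ^ 'n" where
  "jump x t = torus_rep (fst t) - torus_rep x + snd t"

definition coupling :: "('n torus \<times> 'n torus \<times> (real ^ 'n)) measure" where
  "coupling = density (\<theta> \<Otimes>\<^sub>M targets) (\<lambda>(x, t). rate x t)"

definition cell_plan :: "'n torus \<Rightarrow> (real ^ 'n) measure" where
  "cell_plan x = distr (density targets (rate x)) borel (jump x)"

lemma sigma_finite_Z: "sigma_finite_measure (count_space Z)"
  by (rule sigma_finite_measure_count_space_finite[OF finite_Z])

lemma pair_theta_Z: "pair_sigma_finite \<theta> (count_space Z)"
  by (intro pair_sigma_finite.intro sigma_finite_Z theta.sigma_finite_measure_axioms)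

lemma sigma_finite_targets: "sigma_finite_measure targets"
  unfolding targets_def
  by (intro sigma_finite_pair_measure theta.sigma_finite_measure_axioms sigma_finite_Z)

lemma sets_targets [measurable_cong]: "sets targets = sets (borel \<Otimes>\<^sub>M count_space Z)"
  unfolding targets_def by (intro sets_pair_measure_cong sets_theta refl)

lemma sets_coupling [measurable_cong]: "sets coupling = sets (borel \<Otimes>\<^sub>M (borel \<Otimes>\<^sub>M count_space Z))"
  unfolding coupling_def sets_density
  by (intro sets_pair_measure_cong sets_theta sets_targets)

lemma cell_triple_measurable:
  "(\<lambda>(x, t). (c x, c (fst t), snd t)) \<in> borel \<Otimes>\<^sub>M (borel \<Otimes>\<^sub>M count_space Z) \<rightarrow>\<^sub>M count_space (F \<times> F \<times> Z)"
proof -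
  have "(\<lambda>(x, t). (c x, c (fst t), snd t)) \<in> borel \<Otimes>\<^sub>M (borel \<Otimes>\<^sub>M count_space Z) \<rightarrow>\<^sub>M
      count_space F \<Otimes>\<^sub>M (count_space F \<Otimes>\<^sub>M count_space Z)"
    using c_measurable unfolding split_beta by measurable
  then show ?thesis
    using finite_F finite_Z by (simp add: pair_measure_countable countable_finite)
qed

lemma rate_measurable: "(\<lambda>(x, t). rate x t) \<in> borel_measurable (borel \<Otimes>\<^sub>M (borel \<Otimes>\<^sub>M count_space Z))"
proof -
  have "(\<lambda>(a, b, z). ennreal (q (a, b, z) / (w a * w b))) \<in> borel_measurable (count_space (F \<times> F \<times> Z))"
    by simp
  from measurable_compose[OF cell_triple_measurable this] show ?thesis
    by (simp add: rate_def split_beta)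
qed

lemma jump_measurable: "(\<lambda>(x, t). jump x t) \<in> borel_measurable (borel \<Otimes>\<^sub>M (borel \<Otimes>\<^sub>M count_space Z))"
proof -
  have "(\<lambda>z. z) \<in> count_space Z \<rightarrow>\<^sub>M (borel :: (real ^ 'n) measure)" by simp
  from measurable_compose[OF measurable_compose[OF measurable_snd measurable_snd] this]
  have [measurable]: "(\<lambda>p. snd (snd p)) \<in> borel_measurable
      ((borel :: 'n torus measure) \<Otimes>\<^sub>M ((borel :: 'n torus measure) \<Otimes>\<^sub>M count_space Z))" .
  show ?thesis unfolding jump_def split_beta by measurable
qed

lemma nn_integral_targets:
  assumes "f \<in> borel_measurable (borel \<Otimes>\<^sub>M count_space Z)"
  shows "(\<integral>\<^sup>+t. f t \<partial>targets) = (\<Sum>z\<in>Z. \<integral>\<^sup>+y. f (y, z) \<partial>\<theta>)"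
proof -
  interpret pair_sigma_finite \<theta> "count_space Z" by (rule pair_theta_Z)
  have "f \<in> borel_measurable (\<theta> \<Otimes>\<^sub>M count_space Z)" using assms by measurable
  from nn_integral_snd[OF this, symmetric] show ?thesis
    using finite_Z by (simp add: targets_def nn_integral_count_space_finite)
qed

lemma nn_integral_coupling_iterated:
  assumes [measurable]: "f \<in> borel_measurable (borel \<Otimes>\<^sub>M (borel \<Otimes>\<^sub>M count_space Z))"
  shows "(\<integral>\<^sup>+p. f p \<partial>coupling) = (\<integral>\<^sup>+x. \<integral>\<^sup>+t. rate x t * f (x, t) \<partial>targets \<partial>\<theta>)"
proof -
  interpret targets: sigma_finite_measure targets by (rule sigma_finite_targets)
  note [measurable] = rate_measurable
  have "(\<integral>\<^sup>+p. f p \<partial>coupling) = (\<integral>\<^sup>+p. (case p of (x, t) \<Rightarrow> rate x t) * f p \<partial>(\<theta> \<Otimes>\<^sub>M targets))"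
    unfolding coupling_def by (intro nn_integral_density) measurable
  also have "\<dots> = (\<integral>\<^sup>+x. \<integral>\<^sup>+t. (case (x, t) of (x, t) \<Rightarrow> rate x t) * f (x, t) \<partial>targets \<partial>\<theta>)"
    by (intro targets.nn_integral_fst[symmetric]) measurable
  finally show ?thesis by simp
qed

text \<open>The sum over the shifts is taken outside, which leaves a symmetric double integral over
  \<open>\<theta>\<close> in which source and target may be interchanged.\<close>

lemma nn_integral_coupling:
  assumes f [measurable]: "f \<in> borel_measurable (borel \<Otimes>\<^sub>M (borel \<Otimes>\<^sub>M count_space Z))"
  shows "(\<integral>\<^sup>+p. f p \<partial>coupling) = (\<Sum>z\<in>Z. \<integral>\<^sup>+x. \<integral>\<^sup>+y. rate x (y, z) * f (x, y, z) \<partial>\<theta> \<partial>\<theta>)"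
proof -
  note [measurable] = rate_measurable
  have 1: "(\<integral>\<^sup>+t. rate x t * f (x, t) \<partial>targets) = (\<Sum>z\<in>Z. \<integral>\<^sup>+y. rate x (y, z) * f (x, y, z) \<partial>\<theta>)" for x
  proof (rule nn_integral_targets)
    have "(\<lambda>t. (\<lambda>(x, t). rate x t) (x, t) * f (x, t)) \<in> borel_measurable (borel \<Otimes>\<^sub>M count_space Z)" by measurable
    then show "(\<lambda>t. rate x t * f (x, t)) \<in> borel_measurable (borel \<Otimes>\<^sub>M count_space Z)" by simp
  qed
  have 2: "(\<lambda>x. \<integral>\<^sup>+y. rate x (y, z) * f (x, y, z) \<partial>\<theta>) \<in> borel_measurable \<theta>" if [simp]: "z \<in> Z" for z
  proof -
    have "(\<lambda>(x, y). (\<lambda>(x, t). rate x t) (x, (y, z)) * f (x, (y, z))) \<in> borel_measurable (\<theta> \<Otimes>\<^sub>M \<theta>)" by measurable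
    from theta.borel_measurable_nn_integral_fst[OF this] show ?thesis by simp
  qed
  show ?thesis
    unfolding nn_integral_coupling_iterated[OF f] 1 using 2 by (intro nn_integral_sum) auto
qed

lemma rate_mass:
  assumes "a \<in> F" "b \<in> F"
  shows "ennreal (w b) * ennreal (q (a, b, z) / (w a * w b)) = ennreal (q (a, b, z) / w a)"
    and "ennreal (w a) * ennreal (q (a, b, z) / (w a * w b)) = ennreal (q (a, b, z) / w b)"
proof -
  have w: "w a > 0" "w b > 0" using assms w_pos by auto
  have "w b * (q (a, b, z) / (w a * w b)) = q (a, b, z) / w a"
    "w a * (q (a, b, z) / (w a * w b)) = q (a, b, z) / w b"
    using w by auto
  then show "ennreal (w b) * ennreal (q (a, b, z) / (w a * w b)) = ennreal (q (a, b, z) / w a)"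
    and "ennreal (w a) * ennreal (q (a, b, z) / (w a * w b)) = ennreal (q (a, b, z) / w b)"
    using ennreal_mult'[of "w b" "q (a, b, z) / (w a * w b)"] ennreal_mult'[of "w a" "q (a, b, z) / (w a * w b)"] w
    by simp_all
qed

lemma rate_total_out: "(\<Sum>z\<in>Z. \<integral>\<^sup>+y. rate x (y, z) \<partial>\<theta>) = 1"
proof -
  have "(\<integral>\<^sup>+y. rate x (y, z) \<partial>\<theta>) = (\<Sum>b\<in>F. ennreal (q (c x, b, z) / w (c x)))" for z
    unfolding rate_def fst_conv snd_conv
    using nn_integral_cells[of "\<lambda>b. ennreal (q (c x, b, z) / (w (c x) * w b))"] by (simp add: rate_mass(1))
  then have "(\<Sum>z\<in>Z. \<integral>\<^sup>+y. rate x (y, z) \<partial>\<theta>) = ennreal (\<Sum>z\<in>Z. \<Sum>b\<in>F. q (c x, b, z) / w (c x))"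
    using w_pos[of "c x"] q_nonneg by (simp add: sum_nonneg)
  also have "\<dots> = 1" using w_pos[of "c x"] q_row[of "c x"] by (simp flip: sum_divide_distrib)
  finally show ?thesis .
qed

lemma rate_total_in: "(\<Sum>z\<in>Z. \<integral>\<^sup>+x. rate x (y, z) \<partial>\<theta>) = 1"
proof -
  have "(\<integral>\<^sup>+x. rate x (y, z) \<partial>\<theta>) = (\<Sum>a\<in>F. ennreal (q (a, c y, z) / w (c y)))" for z
    unfolding rate_def fst_conv snd_conv
    using nn_integral_cells[of "\<lambda>a. ennreal (q (a, c y, z) / (w a * w (c y)))"] by (simp add: rate_mass(2))
  then have "(\<Sum>z\<in>Z. \<integral>\<^sup>+x. rate x (y, z) \<partial>\<theta>) = ennreal (\<Sum>z\<in>Z. \<Sum>a\<in>F. q (a, c y, z) / w (c y))"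
    using w_pos[of "c y"] q_nonneg by (simp add: sum_nonneg)
  also have "\<dots> = 1" using w_pos[of "c y"] q_col[of "c y"] by (simp flip: sum_divide_distrib)
  finally show ?thesis .
qed

lemma rate_slice_measurable [measurable]: "rate x \<in> borel_measurable (borel \<Otimes>\<^sub>M count_space Z)"
proof -
  have "Pair x \<in> (borel \<Otimes>\<^sub>M count_space Z) \<rightarrow>\<^sub>M borel \<Otimes>\<^sub>M (borel \<Otimes>\<^sub>M count_space Z)"
    by (rule measurable_Pair1') simp
  from measurable_compose[OF this rate_measurable] show ?thesis by (simp only: prod.case)
qed

lemma jump_slice_measurable [measurable]: "jump x \<in> borel_measurable (borel \<Otimes>\<^sub>M count_space Z)"
proof -
  have "Pair x \<in> (borel \<Otimes>\<^sub>M count_space Z) \<rightarrow>\<^sub>M borel \<Otimes>\<^sub>M (borel \<Otimes>\<^sub>M count_space Z)"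
    by (rule measurable_Pair1') simp
  from measurable_compose[OF this jump_measurable] show ?thesis by (simp only: prod.case)
qed

lemma prob_space_rate: "prob_space (density targets (rate x))"
proof
  have "emeasure (density targets (rate x)) (space (density targets (rate x))) = (\<integral>\<^sup>+t. rate x t \<partial>targets)"
    by (simp add: emeasure_density cong: nn_integral_cong)
  also have "\<dots> = 1" using rate_total_out[of x] by (simp add: nn_integral_targets)
  finally show "emeasure (density targets (rate x)) (space (density targets (rate x))) = 1" .
qed

lemma cell_plan_kernel: "cell_plan \<in> borel \<rightarrow>\<^sub>M prob_algebra borel"
proof (rule measurable_prob_algebraI)
  show "prob_space (cell_plan x)" for x
    unfolding cell_plan_def by (intro prob_space.prob_space_distr prob_space_rate) measurable
  interpret targets: sigma_finite_measure targets by (rule sigma_finite_targets)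
  have "(\<lambda>x. density targets (rate x)) \<in> borel \<rightarrow>\<^sub>M subprob_algebra targets"
  proof (rule measurable_subprob_algebra)
    show "subprob_space (density targets (rate x))" for x
      by (rule prob_space_imp_subprob_space[OF prob_space_rate])
    show "sets (density targets (rate x)) = sets targets" for x by simp
    fix A assume A [measurable]: "A \<in> sets targets"
    have "(\<lambda>(x, t). rate x t * indicator A t) \<in> borel_measurable (borel \<Otimes>\<^sub>M targets)"
      using rate_measurable unfolding split_beta by measurable
    then have "(\<lambda>x. \<integral>\<^sup>+t. rate x t * indicator A t \<partial>targets) \<in> borel_measurable borel"
      by (rule targets.borel_measurable_nn_integral)
    then show "(\<lambda>x. emeasure (density targets (rate x)) A) \<in> borel_measurable borel"
      by (simp add: emeasure_density)
  qed
  moreover have "case_prod jump \<in> borel \<Otimes>\<^sub>M targets \<rightarrow>\<^sub>M borel"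
    using jump_measurable
    by (subst measurable_cong_sets[OF sets_pair_measure_cong[OF refl sets_targets] refl])
  ultimately have "(\<lambda>x. distr (density targets (rate x)) borel (jump x)) \<in> borel \<rightarrow>\<^sub>M subprob_algebra borel"
    by (intro measurable_distr2)
  then show "cell_plan \<in> borel \<rightarrow>\<^sub>M subprob_algebra borel"
    by (simp only: cell_plan_def[abs_def])
qed

sublocale kernel_plan \<theta> cell_plan
  using \<theta> cell_plan_kernel by unfold_locales

lemma graph_measurable [measurable]:
  "(\<lambda>(x, t). (x, jump x t)) \<in> borel \<Otimes>\<^sub>M (borel \<Otimes>\<^sub>M count_space Z) \<rightarrow>\<^sub>M borel \<Otimes>\<^sub>M borel"
proof -
  have [measurable]: "(\<lambda>p. jump (fst p) (snd p)) \<in> borel_measurable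
      ((borel :: 'n torus measure) \<Otimes>\<^sub>M ((borel :: 'n torus measure) \<Otimes>\<^sub>M count_space Z))"
    using jump_measurable by (simp add: split_beta')
  show ?thesis unfolding split_beta by measurable
qed

lemma plan_measure_cell_plan:
  "plan_measure \<theta> cell_plan = distr coupling (borel \<Otimes>\<^sub>M borel) (\<lambda>(x, t). (x, jump x t))"
proof (rule measure_eqI)
  fix A assume "A \<in> sets (plan_measure \<theta> cell_plan)"
  then have A [measurable]: "A \<in> sets (borel \<Otimes>\<^sub>M borel)" by (simp add: sets_plan_measure)
  have "emeasure (plan_measure \<theta> cell_plan) A = (\<integral>\<^sup>+z. indicator A z \<partial>plan_measure \<theta> cell_plan)"
    by (rule nn_integral_indicator[symmetric]) (simp add: sets_plan_measure)
  also have "\<dots> = (\<integral>\<^sup>+x. \<integral>\<^sup>+v. indicator A (x, v) \<partial>cell_plan x \<partial>\<theta>)"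
    by (rule nn_integral_plan_measure) measurable
  also have "\<dots> = (\<integral>\<^sup>+x. \<integral>\<^sup>+t. rate x t * indicator A (x, jump x t) \<partial>targets \<partial>\<theta>)"
  proof (rule nn_integral_cong)
    fix x
    have [measurable]: "(\<lambda>v. indicator A (x, v) :: ennreal) \<in> borel_measurable borel"
      by (rule measurable_compose[OF measurable_Pair1'[where ?M1.0 = borel]]) simp_all
    have "(\<integral>\<^sup>+v. indicator A (x, v) \<partial>cell_plan x) = (\<integral>\<^sup>+t. indicator A (x, jump x t) \<partial>density targets (rate x))"
      unfolding cell_plan_def by (rule nn_integral_distr) measurable
    also have "\<dots> = (\<integral>\<^sup>+t. rate x t * indicator A (x, jump x t) \<partial>targets)"
      by (rule nn_integral_density) measurable
    finally show "(\<integral>\<^sup>+v. indicator A (x, v) \<partial>cell_plan x) = (\<integral>\<^sup>+t. rate x t * indicator A (x, jump x t) \<partial>targets)" .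
  qed
  also have "\<dots> = (\<integral>\<^sup>+p. indicator A ((\<lambda>(x, t). (x, jump x t)) p) \<partial>coupling)"
    using nn_integral_coupling_iterated[OF measurable_compose[OF graph_measurable borel_measurable_indicator[OF A]]]
    by (simp only: prod.case)
  also have "\<dots> = (\<integral>\<^sup>+z. indicator A z \<partial>distr coupling (borel \<Otimes>\<^sub>M borel) (\<lambda>(x, t). (x, jump x t)))"
    by (rule nn_integral_distr[symmetric]) measurable
  also have "\<dots> = emeasure (distr coupling (borel \<Otimes>\<^sub>M borel) (\<lambda>(x, t). (x, jump x t))) A"
    by (rule nn_integral_indicator) simp
  finally show "emeasure (plan_measure \<theta> cell_plan) A =
      emeasure (distr coupling (borel \<Otimes>\<^sub>M borel) (\<lambda>(x, t). (x, jump x t))) A" .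
qed (simp add: sets_plan_measure)

text \<open>Both the starting point and the landing point are distributed like \<open>\<theta>\<close>: for the first this
  holds since \<open>rate\<close> is a probability density in the target, for the second since it also
  integrates to one in the source. These are the row and column conditions on \<open>q\<close>.\<close>

lemma distr_coupling_fst: "distr coupling borel fst = \<theta>"
proof (rule measure_eqI)
  fix A assume "A \<in> sets (distr coupling borel fst)"
  then have A [measurable]: "A \<in> sets borel" by simp
  have "emeasure (distr coupling borel fst) A = (\<integral>\<^sup>+p. indicator A (fst p) \<partial>coupling)"
    using nn_integral_distr[of fst coupling borel "indicator A"] by simp
  also have "\<dots> = (\<integral>\<^sup>+x. \<integral>\<^sup>+t. rate x t * indicator A (fst (x, t)) \<partial>targets \<partial>\<theta>)"
    by (rule nn_integral_coupling_iterated) measurable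
  also have "\<dots> = (\<integral>\<^sup>+x. indicator A x \<partial>\<theta>)"
  proof (rule nn_integral_cong)
    fix x
    have "(\<integral>\<^sup>+t. rate x t * indicator A (fst (x, t)) \<partial>targets) = (\<integral>\<^sup>+t. rate x t \<partial>targets) * indicator A x"
      unfolding fst_conv by (rule nn_integral_multc) measurable
    also have "(\<integral>\<^sup>+t. rate x t \<partial>targets) = 1"
      using rate_total_out[of x] by (simp add: nn_integral_targets)
    finally show "(\<integral>\<^sup>+t. rate x t * indicator A (fst (x, t)) \<partial>targets) = indicator A x" by simp
  qed
  also have "\<dots> = emeasure \<theta> A" by (simp add: sets_theta)
  finally show "emeasure (distr coupling borel fst) A = emeasure \<theta> A" .
qed (simp add: sets_theta)

lemma distr_coupling_target: "distr coupling borel (\<lambda>p. fst (snd p)) = \<theta>"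
proof (rule measure_eqI)
  fix A assume "A \<in> sets (distr coupling borel (\<lambda>p. fst (snd p)))"
  then have A [measurable]: "A \<in> sets borel" by simp
  have psf: "pair_sigma_finite \<theta> \<theta>"
    by (intro pair_sigma_finite.intro theta.sigma_finite_measure_axioms)
  have sets_pair: "sets (\<theta> \<Otimes>\<^sub>M \<theta>) = sets (borel \<Otimes>\<^sub>M borel)"
    by (intro sets_pair_measure_cong sets_theta)
  have m1: "(\<lambda>p. rate (fst p) (snd p, z)) \<in> borel_measurable (borel \<Otimes>\<^sub>M borel)" if z: "z \<in> Z" for z
  proof -
    have "(\<lambda>p :: 'n torus \<times> 'n torus. (fst p, snd p, z)) \<in> borel \<Otimes>\<^sub>M borel \<rightarrow>\<^sub>M borel \<Otimes>\<^sub>M (borel \<Otimes>\<^sub>M count_space Z)"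
      using z by (intro measurable_Pair measurable_fst measurable_snd measurable_const) simp
    from measurable_compose[OF this rate_measurable] show ?thesis by (simp only: prod.case)
  qed
  have m: "(\<lambda>(x, y). rate x (y, z) * indicator A y) \<in> borel_measurable (\<theta> \<Otimes>\<^sub>M \<theta>)" if z: "z \<in> Z" for z
    unfolding split_beta' measurable_cong_sets[OF sets_pair refl]
    by (intro borel_measurable_times_ennreal m1[OF z] measurable_compose[OF measurable_snd] borel_measurable_indicator A)
  have m2: "(\<lambda>x. rate x (y, z)) \<in> borel_measurable \<theta>" if z: "z \<in> Z" for y z
  proof -
    have "(\<lambda>x :: 'n torus. (x, y)) \<in> borel \<rightarrow>\<^sub>M borel \<Otimes>\<^sub>M borel" by (rule measurable_Pair2') simp
    from measurable_compose[OF this m1[OF z]] show ?thesis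
      unfolding measurable_cong_sets[OF sets_theta refl] by (simp only: fst_conv snd_conv)
  qed
  have m3: "(\<lambda>y. \<integral>\<^sup>+x. rate x (y, z) * indicator A y \<partial>\<theta>) \<in> borel_measurable \<theta>" if "z \<in> Z" for z
    using theta.borel_measurable_nn_integral_fst[OF measurable_pair_swap[OF m[OF that]]] by simp
  have "emeasure (distr coupling borel (\<lambda>p. fst (snd p))) A = (\<integral>\<^sup>+p. indicator A (fst (snd p)) \<partial>coupling)"
    using nn_integral_distr[of "\<lambda>p. fst (snd p)" coupling borel "indicator A"] by simp
  also have "\<dots> = (\<Sum>z\<in>Z. \<integral>\<^sup>+x. \<integral>\<^sup>+y. rate x (y, z) * indicator A (fst (snd (x, y, z))) \<partial>\<theta> \<partial>\<theta>)"
    by (rule nn_integral_coupling) measurable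
  also have "\<dots> = (\<Sum>z\<in>Z. \<integral>\<^sup>+y. \<integral>\<^sup>+x. rate x (y, z) * indicator A y \<partial>\<theta> \<partial>\<theta>)"
    using pair_sigma_finite.Fubini'[OF psf m] by (intro sum.cong) auto
  also have "\<dots> = (\<integral>\<^sup>+y. (\<Sum>z\<in>Z. \<integral>\<^sup>+x. rate x (y, z) * indicator A y \<partial>\<theta>) \<partial>\<theta>)"
    using m3 by (intro nn_integral_sum[symmetric]) auto
  also have "\<dots> = (\<integral>\<^sup>+y. indicator A y \<partial>\<theta>)"
  proof (rule nn_integral_cong)
    fix y
    have "(\<Sum>z\<in>Z. \<integral>\<^sup>+x. rate x (y, z) * indicator A y \<partial>\<theta>) =
        (\<Sum>z\<in>Z. (\<integral>\<^sup>+x. rate x (y, z) \<partial>\<theta>) * indicator A y)"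
      using m2 by (intro sum.cong refl nn_integral_multc)
    also have "\<dots> = indicator A y" using rate_total_in[of y] by (simp flip: sum_distrib_right)
    finally show "(\<Sum>z\<in>Z. \<integral>\<^sup>+x. rate x (y, z) * indicator A y \<partial>\<theta>) = indicator A y" .
  qed
  also have "\<dots> = emeasure \<theta> A" by (simp add: sets_theta)
  finally show "emeasure (distr coupling borel (\<lambda>p. fst (snd p))) A = emeasure \<theta> A" .
qed (simp add: sets_theta)

lemma distr_coupling_cells:
  "distr coupling (count_space (F \<times> F \<times> Z)) (\<lambda>(x, t). (c x, c (fst t), snd t)) = point_measure (F \<times> F \<times> Z) q"
proof (rule measure_eqI_finite[where A = "F \<times> F \<times> Z"])
  fix m assume m: "m \<in> F \<times> F \<times> Z"
  let ?k = "\<lambda>(x, t). (c x, c (fst t), snd t)"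
  obtain a b z where mabz: "m = (a, b, z)" by (cases m)
  have abz: "a \<in> F" "b \<in> F" "z \<in> Z" using m mabz by auto
  note [measurable] = cell_triple_measurable
  have i: "(\<lambda>p. indicator {m} (?k p) :: ennreal) \<in> borel_measurable (borel \<Otimes>\<^sub>M (borel \<Otimes>\<^sub>M count_space Z))"
    by (rule measurable_compose[OF cell_triple_measurable]) simp
  have "emeasure (distr coupling (count_space (F \<times> F \<times> Z)) ?k) {m} = (\<integral>\<^sup>+p. indicator {m} (?k p) \<partial>coupling)"
    using nn_integral_distr[of ?k coupling "count_space (F \<times> F \<times> Z)" "indicator {m}"] m by simp
  also have "\<dots> = (\<Sum>z'\<in>Z. \<integral>\<^sup>+x. \<integral>\<^sup>+y. rate x (y, z') * indicator {m} (?k (x, y, z')) \<partial>\<theta> \<partial>\<theta>)"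
    by (rule nn_integral_coupling[OF i])
  also have "\<dots> = (\<Sum>z'\<in>Z. if z' = z then ennreal (q m) else 0)"
  proof (intro sum.cong refl)
    fix z'
    define G where "G a' b' = ennreal (q (a', b', z') / (w a' * w b')) * indicator {m} (a', b', z')" for a' b'
    have "(\<integral>\<^sup>+x. \<integral>\<^sup>+y. rate x (y, z') * indicator {m} (?k (x, y, z')) \<partial>\<theta> \<partial>\<theta>) = (\<integral>\<^sup>+x. \<integral>\<^sup>+y. G (c x) (c y) \<partial>\<theta> \<partial>\<theta>)"
      by (simp add: rate_def G_def)
    also have "\<dots> = (\<Sum>a'\<in>F. ennreal (w a') * (\<Sum>b'\<in>F. ennreal (w b') * G a' b'))"
      by (simp add: nn_integral_cells nn_integral_cells[of "\<lambda>a'. \<Sum>b'\<in>F. ennreal (w b') * G a' b'"])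
    also have "\<dots> = (\<Sum>a'\<in>F. \<Sum>b'\<in>F. ennreal (w a') * (ennreal (w b') * G a' b'))"
      by (simp add: sum_distrib_left)
    also have "\<dots> = (\<Sum>a'\<in>F. if a' = a then \<Sum>b'\<in>F. if b' = b then
        (if z' = z then ennreal (w a) * (ennreal (w b) * G a b) else 0) else 0 else 0)"
      by (intro sum.cong refl) (auto simp: G_def mabz intro!: sum.cong sum.neutral)
    also have "\<dots> = (if z' = z then ennreal (w a) * (ennreal (w b) * G a b) else 0)"
      using abz finite_F by simp
    also have "\<dots> = (if z' = z then ennreal (q m) else 0)"
    proof -
      have "ennreal (w a) * ennreal (q (a, b, z) / w a) = ennreal (w a * (q (a, b, z) / w a))"
        using w_pos[OF abz(1)] by (intro ennreal_mult'[symmetric]) simp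
      also have "w a * (q (a, b, z) / w a) = q (a, b, z)" using w_pos[OF abz(1)] by simp
      finally show ?thesis using abz by (simp add: G_def mabz rate_mass(1))
    qed
    finally show "(\<integral>\<^sup>+x. \<integral>\<^sup>+y. rate x (y, z') * indicator {m} (?k (x, y, z')) \<partial>\<theta> \<partial>\<theta>) = (if z' = z then ennreal (q m) else 0)" .
  qed
  also have "\<dots> = ennreal (q m)" using abz finite_Z by simp
  also have "\<dots> = emeasure (point_measure (F \<times> F \<times> Z) q) {m}"
    using m finite_F finite_Z by (subst emeasure_point_measure_finite) auto
  finally show "emeasure (distr coupling (count_space (F \<times> F \<times> Z)) ?k) {m} = emeasure (point_measure (F \<times> F \<times> Z) q) {m}" .
qed (use finite_F finite_Z in \<open>auto simp: sets_point_measure\<close>)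

lemma integral_coupling_cells:
  fixes f :: "(real ^ 'n) \<times> (real ^ 'n) \<times> (real ^ 'n) \<Rightarrow> 'b::{banach, second_countable_topology}"
  shows "integrable coupling (\<lambda>(x, t). f (c x, c (fst t), snd t))" (is ?I)
    and "(\<integral>(x, t). f (c x, c (fst t), snd t) \<partial>coupling) = (\<Sum>m\<in>F \<times> F \<times> Z. q m *\<^sub>R f m)" (is ?E)
proof -
  let ?k = "\<lambda>(x, t). (c x, c (fst t), snd t)"
  have k: "?k \<in> coupling \<rightarrow>\<^sub>M count_space (F \<times> F \<times> Z)" using cell_triple_measurable by measurable
  have fin: "finite (F \<times> F \<times> Z)" using finite_F finite_Z by simp
  have "integrable (point_measure (F \<times> F \<times> Z) q) f"
    by (rule integrable_point_measure_finite[OF fin])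
  then have "integrable coupling (\<lambda>p. f (?k p))"
    unfolding distr_coupling_cells[symmetric] by (subst (asm) integrable_distr_eq[OF k]) auto
  then show ?I by (simp add: split_beta')
  have "(\<integral>p. f (?k p) \<partial>coupling) = (\<integral>m. f m \<partial>point_measure (F \<times> F \<times> Z) q)"
    unfolding distr_coupling_cells[symmetric] by (rule integral_distr[OF k, symmetric]) simp
  also have "\<dots> = (\<Sum>m\<in>F \<times> F \<times> Z. q m *\<^sub>R f m)"
    using fin q_nonneg by (rule lebesgue_integral_point_measure_finite)
  finally show ?E by (simp add: split_beta')
qed

lemma prob_space_coupling: "prob_space coupling"
proof (rule prob_space_distrD)
  show "fst \<in> coupling \<rightarrow>\<^sub>M borel" unfolding measurable_cong_sets[OF sets_coupling refl] by (rule measurable_fst)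
  show "prob_space (distr coupling borel fst)"
    unfolding distr_coupling_fst by (rule theta.prob_space_axioms)
qed

lemma space_coupling: "space coupling = UNIV \<times> UNIV \<times> Z"
  using sets_eq_imp_space_eq[OF sets_coupling] by (simp add: space_pair_measure)

lemma torus_add_jump: "z \<in> Z \<Longrightarrow> x +\<^sub>T jump x (y, z) = y"
proof -
  assume "z \<in> Z"
  then have z: "z \<in> lattice_vectors" using Z_lattice by blast
  have "x +\<^sub>T jump x (y, z) = abs_torus (torus_rep x) +\<^sub>T jump x (y, z)" by simp
  also have "\<dots> = abs_torus (torus_rep y + z)"
    unfolding abs_torus_add jump_def by (simp add: algebra_simps)
  also have "\<dots> = y" using z by simp
  finally show ?thesis .
qed

lemma integral_plan_measure_cell_plan:
  fixes f :: "'n torus \<times> (real ^ 'n) \<Rightarrow> 'b::{banach, second_countable_topology}"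
  assumes "f \<in> borel_measurable (borel \<Otimes>\<^sub>M borel)"
  shows "integrable (plan_measure \<theta> cell_plan) f \<longleftrightarrow> integrable coupling (\<lambda>p. f (fst p, jump (fst p) (snd p)))"
    and "(\<integral>z. f z \<partial>plan_measure \<theta> cell_plan) = (\<integral>p. f (fst p, jump (fst p) (snd p)) \<partial>coupling)"
proof -
  have g: "(\<lambda>(x, t). (x, jump x t)) \<in> coupling \<rightarrow>\<^sub>M borel \<Otimes>\<^sub>M borel"
    unfolding measurable_cong_sets[OF sets_coupling refl] by (rule graph_measurable)
  show "integrable (plan_measure \<theta> cell_plan) f \<longleftrightarrow> integrable coupling (\<lambda>p. f (fst p, jump (fst p) (snd p)))"
    unfolding plan_measure_cell_plan integrable_distr_eq[OF g assms] by (simp add: split_beta')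
  show "(\<integral>z. f z \<partial>plan_measure \<theta> cell_plan) = (\<integral>p. f (fst p, jump (fst p) (snd p)) \<partial>coupling)"
    unfolding plan_measure_cell_plan integral_distr[OF g assms] by (simp add: split_beta')
qed

lemma integral_coupling_marginals:
  fixes f :: "'n torus \<Rightarrow> 'b::{banach, second_countable_topology}"
  assumes f: "f \<in> borel_measurable borel"
  shows "integrable \<theta> f \<Longrightarrow> integrable coupling (\<lambda>p. f (fst p))"
    and "(\<integral>p. f (fst p) \<partial>coupling) = (\<integral>x. f x \<partial>\<theta>)"
    and "integrable \<theta> f \<Longrightarrow> integrable coupling (\<lambda>p. f (fst (snd p)))"
    and "(\<integral>p. f (fst (snd p)) \<partial>coupling) = (\<integral>x. f x \<partial>\<theta>)"
proof -
  have 1: "fst \<in> coupling \<rightarrow>\<^sub>M borel"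
    unfolding measurable_cong_sets[OF sets_coupling refl] by (rule measurable_fst)
  have 2: "(\<lambda>p. fst (snd p)) \<in> coupling \<rightarrow>\<^sub>M borel"
    unfolding measurable_cong_sets[OF sets_coupling refl]
    by (rule measurable_compose[OF measurable_snd measurable_fst])
  show "integrable \<theta> f \<Longrightarrow> integrable coupling (\<lambda>p. f (fst p))"
    using integrable_distr_eq[OF 1 f] by (simp add: distr_coupling_fst)
  show "(\<integral>p. f (fst p) \<partial>coupling) = (\<integral>x. f x \<partial>\<theta>)"
    using integral_distr[OF 1 f] by (simp add: distr_coupling_fst)
  show "integrable \<theta> f \<Longrightarrow> integrable coupling (\<lambda>p. f (fst (snd p)))"
    using integrable_distr_eq[OF 2 f] by (simp add: distr_coupling_target)
  show "(\<integral>p. f (fst (snd p)) \<partial>coupling) = (\<integral>x. f x \<partial>\<theta>)"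
    using integral_distr[OF 2 f] by (simp add: distr_coupling_target)
qed

text \<open>Invariance holds since the landing point has law \<open>\<theta>\<close>. For the mean, the velocity
  \<open>y - x + z\<close> differs from the discrete velocity \<open>c(y) - c(x) + z\<close> by
  \<open>(y - c(y)) - (x - c(x))\<close>, whose mean is zero because \<open>x\<close> and \<open>y\<close> have the same law.\<close>

lemma cell_plan_in_plans:
  assumes mean: "(\<Sum>(a, b, z)\<in>F \<times> F \<times> Z. q (a, b, z) *\<^sub>R (b - a + z)) = Q"
  shows "cell_plan \<in> plans \<theta> Q"
proof -
  let ?e = "\<lambda>x. torus_rep x - c x"
  have c_borel: "c \<in> borel_measurable borel"
    by (rule measurable_compose[OF c_measurable, of "\<lambda>x. x", simplified]) simp
  have e_meas: "?e \<in> borel_measurable borel"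
    by (intro borel_measurable_diff torus_rep_measurable c_borel)
  have e_int: "integrable \<theta> ?e"
  proof -
    obtain B where B: "\<And>x. x \<in> torus_cube \<Longrightarrow> norm (x :: real ^ 'n) \<le> B"
      using compact_imp_bounded[OF compact_torus_cube] unfolding bounded_iff by blast
    have "norm (c x) \<le> (\<Sum>a\<in>F. norm a)" for x
      using member_le_sum[of "c x" F norm] finite_F by simp
    then have bound: "norm (?e x) \<le> B + (\<Sum>a\<in>F. norm a)" for x
      using B[OF torus_rep_in_cube, of x] norm_triangle_ineq4[of "torus_rep x" "c x"] by (smt (verit))
    have "?e \<in> borel_measurable \<theta>"
      unfolding measurable_cong_sets[OF sets_theta refl] by (rule e_meas)
    then show ?thesis
      by (rule theta.integrable_const_bound[OF AE_I2[OF bound]])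
  qed
  let ?f = "\<lambda>(a, b, z). b - a + z :: real ^ 'n"
  have cells: "integrable coupling (\<lambda>p. ?f (c (fst p), c (fst (snd p)), snd (snd p)))"
    "(\<integral>p. ?f (c (fst p), c (fst (snd p)), snd (snd p)) \<partial>coupling) = Q"
    using integral_coupling_cells[of ?f] mean by (simp_all add: split_beta')
  note marg = integral_coupling_marginals[OF e_meas]
  have jump_split: "jump (fst p) (snd p) = (?e (fst (snd p)) - ?e (fst p)) + ?f (c (fst p), c (fst (snd p)), snd (snd p))" for p
    by (simp add: jump_def)
  have jump_int: "integrable coupling (\<lambda>p. jump (fst p) (snd p))"
    unfolding jump_split
    by (intro Bochner_Integration.integrable_add Bochner_Integration.integrable_diff marg(1,3) e_int cells(1))
  have "(\<integral>p. jump (fst p) (snd p) \<partial>coupling) = (\<integral>p. ?e (fst (snd p)) - ?e (fst p) \<partial>coupling) +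
      (\<integral>p. ?f (c (fst p), c (fst (snd p)), snd (snd p)) \<partial>coupling)"
    unfolding jump_split
    by (intro Bochner_Integration.integral_add Bochner_Integration.integrable_diff marg(1,3) e_int cells(1))
  also have "(\<integral>p. ?e (fst (snd p)) - ?e (fst p) \<partial>coupling) = 0"
    by (subst Bochner_Integration.integral_diff[OF marg(3)[OF e_int] marg(1)[OF e_int]])
      (simp only: marg(2,4) diff_self)
  also note cells(2)
  finally have jump_mean: "(\<integral>p. jump (fst p) (snd p) \<partial>coupling) = Q" by simp
  have snd_meas: "(\<lambda>(x :: 'n torus, v :: real ^ 'n). v) \<in> borel_measurable (borel \<Otimes>\<^sub>M borel)"
    unfolding split_beta' by (rule measurable_snd)
  have "(\<integral>(x, v). \<phi> (x +\<^sub>T v) \<partial>plan_measure \<theta> cell_plan) = (\<integral>x. \<phi> x \<partial>\<theta>)"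
    if \<phi>: "continuous_on UNIV \<phi>" for \<phi> :: "'n torus \<Rightarrow> real"
  proof -
    have "(\<integral>(x, v). \<phi> (x +\<^sub>T v) \<partial>plan_measure \<theta> cell_plan) = (\<integral>p. \<phi> (fst p +\<^sub>T jump (fst p) (snd p)) \<partial>coupling)"
      using integral_plan_measure_cell_plan(2)[OF torus_shift_measurable[OF \<phi>]] by (simp only: prod.case)
    also have "\<dots> = (\<integral>p. \<phi> (fst (snd p)) \<partial>coupling)"
      by (rule Bochner_Integration.integral_cong) (auto simp: space_coupling torus_add_jump)
    also have "\<dots> = (\<integral>x. \<phi> x \<partial>\<theta>)"
      by (rule integral_coupling_marginals(4)[OF borel_measurable_continuous_onI[OF \<phi>]])
    finally show ?thesis .
  qed
  moreover have "integrable (plan_measure \<theta> cell_plan) (\<lambda>(x, v). v)"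
    using integral_plan_measure_cell_plan(1)[OF snd_meas] jump_int by simp
  moreover have "(\<integral>(x, v). v \<partial>plan_measure \<theta> cell_plan) = Q"
    using integral_plan_measure_cell_plan(2)[OF snd_meas] jump_mean by simp
  ultimately show ?thesis
    unfolding plans_def using cell_plan_kernel by blast
qed

end

section \<open>The duality theorem\<close>

lemma sum_triples:
  fixes f :: "'a \<times> 'b \<times> 'c \<Rightarrow> 'd::comm_monoid_add"
  shows "(\<Sum>m\<in>A \<times> B \<times> C. f m) = (\<Sum>a\<in>A. \<Sum>b\<in>B. \<Sum>z\<in>C. f (a, b, z))"
  by (simp add: sum.cartesian_product split_beta)

text \<open>The alternative of \<open>finite_transport_duality\<close> at the level \<open>V + \<epsilon>\<close> is excluded by
  \<open>discrete_dual_below_value\<close>, so a cheap discrete plan exists; the second \<open>\<epsilon>\<close> pays for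
  spreading it over the cells.\<close>

lemma near_optimal_plan:
  fixes L :: "'n::finite torus \<Rightarrow> real ^ 'n \<Rightarrow> real"
  assumes cont: "continuous_on UNIV (\<lambda>(x, v). L (abs_torus x) v)"
    and superlinear: "\<And>A. \<exists>B. \<forall>x v. L x v \<ge> A * norm v - B"
    and val: "\<And>P u x. continuous_on UNIV u \<Longrightarrow>
      (INF v. ereal (L x v + u (x +\<^sub>T v) - u x + P \<bullet> (v - Q))) \<le> ereal V"
    and \<theta>: "\<theta> \<in> space (prob_algebra borel)" and \<epsilon>: "\<epsilon> > 0"
  shows "\<exists>\<pi>\<in>plans \<theta> Q. ext_integral (plan_measure \<theta> \<pi>) (\<lambda>(x, v). ereal (L x v)) \<le> ereal (V + 2 * \<epsilon>)"
proof -
  let ?n = "real CARD('n)"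
  interpret t: prob_space \<theta> using \<theta> by (simp add: space_prob_algebra)
  have sets_t: "sets \<theta> = sets borel" using \<theta> by (simp add: space_prob_algebra)
  then have space_t: "space \<theta> = UNIV" using sets_eq_imp_space_eq by fastforce
  obtain \<rho> where \<rho>: "\<And>F u P a. finite F \<Longrightarrow> F \<subseteq> torus_cube \<Longrightarrow> a \<in> F \<Longrightarrow>
    \<exists>b\<in>F. \<exists>z\<in>lattice_vectors. norm z \<le> \<rho> \<and>
      L (abs_torus a) (b - a + z) + u b - u a + P \<bullet> (b - a + z - Q) \<le> V + \<epsilon>"
    using discrete_dual_below_value[where L = L and V = V and Q = Q and \<epsilon> = \<epsilon>, OF cont superlinear val \<epsilon>] by metis
  let ?K = "torus_cube \<times> cball 0 (?n + \<rho>) :: ((real ^ 'n) \<times> (real ^ 'n)) set"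
  have K: "compact ?K" by (intro compact_Times compact_torus_cube compact_cball)
  have contK: "continuous_on ?K (\<lambda>(x, v). L (abs_torus x) v)"
    using cont by (rule continuous_on_subset) simp
  obtain \<delta>0 where \<delta>0: "\<delta>0 > 0" "\<And>p p'. p \<in> ?K \<Longrightarrow> p' \<in> ?K \<Longrightarrow> dist p' p < \<delta>0 \<Longrightarrow>
      dist ((\<lambda>(x, v). L (abs_torus x) v) p') ((\<lambda>(x, v). L (abs_torus x) v) p) < \<epsilon>"
    using compact_uniformly_continuous[OF contK K] \<epsilon> unfolding uniformly_continuous_on_def by meson
  have "bounded ((\<lambda>(x, v). L (abs_torus x) v) ` ?K)"
    using compact_continuous_image[OF contK K] by (rule compact_imp_bounded)
  then obtain B where B: "\<And>x v. x \<in> torus_cube \<Longrightarrow> norm v \<le> ?n + \<rho> \<Longrightarrow> \<bar>L (abs_torus x) v\<bar> \<le> B"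
    unfolding bounded_iff by fastforce
  \<comment> \<open>Replacing \<open>x\<close> and \<open>y\<close> by \<open>c x\<close> and \<open>c y\<close> moves the pair \<open>(x, v)\<close> by at most three times
    the size of the cells, hence by less than \<open>\<delta>0\<close>.\<close>
  obtain c F where cF: "finite F" "F \<subseteq> torus_cube" "c \<in> borel \<rightarrow>\<^sub>M count_space F"
    "\<And>a. a \<in> F \<Longrightarrow> measure \<theta> (c -` {a}) > 0" "AE x in \<theta>. norm (torus_rep x - c x) \<le> \<delta>0 / 4"
  proof (rule torus_simple_approximation[OF \<theta>])
    show "\<delta>0 / 4 > 0" using \<delta>0(1) by simp
  qed (rule that)
  define Z :: "(real ^ 'n) set" where "Z = {z \<in> lattice_vectors. norm z \<le> \<rho>}"
  have finZ: "finite Z" unfolding Z_def by (rule finite_bounded_lattice_vectors)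
  define w where "w a = measure \<theta> (c -` {a})" for a
  have cF_in: "c x \<in> F" for x using measurable_space[OF cF(3), of x] by simp
  have w_sum: "(\<Sum>a\<in>F. w a) = 1"
  proof -
    have "(\<Union>a\<in>F. c -` {a}) = UNIV" using cF_in by auto
    moreover have "measure \<theta> (\<Union>a\<in>F. c -` {a}) = (\<Sum>a\<in>F. w a)"
      unfolding w_def using cF(1,3)
      by (intro t.finite_measure_finite_Union)
        (auto simp: disjoint_family_on_def measurable_count_space_eq2 sets_t)
    ultimately show ?thesis using t.prob_space space_t by simp
  qed
  define cost where "cost = (\<lambda>(a, b, z). L (abs_torus a) (b - a + z))"
  define D where "D = (\<lambda>(a, b, z). b - a + z :: real ^ 'n)"
  have "\<exists>q. (\<forall>m. 0 \<le> q m) \<and>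
      (\<forall>a\<in>F. (\<Sum>m\<in>F \<times> F \<times> Z. q m * of_bool (fst m = a)) = w a) \<and>
      (\<forall>b\<in>F. (\<Sum>m\<in>F \<times> F \<times> Z. q m * of_bool (fst (snd m) = b)) = w b) \<and>
      (\<Sum>m\<in>F \<times> F \<times> Z. q m *\<^sub>R D m) = Q \<and> (\<Sum>m\<in>F \<times> F \<times> Z. q m * cost m) \<le> V + \<epsilon>"
  proof (rule ccontr)
    assume none: "\<not> ?thesis"
    have w_nonneg: "\<And>a. a \<in> F \<Longrightarrow> 0 \<le> w a" by (simp add: w_def)
    obtain u P a where uPa: "a \<in> F"
      "\<And>b z. b \<in> F \<Longrightarrow> z \<in> Z \<Longrightarrow> V + \<epsilon> < cost (a, b, z) + u b - u a + P \<bullet> (D (a, b, z) - Q)"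
    proof (rule finite_transport_duality[of F Z w D Q "V + \<epsilon>" cost, OF cF(1) finZ w_nonneg w_sum])
      fix q :: "(real ^ 'n) \<times> (real ^ 'n) \<times> (real ^ 'n) \<Rightarrow> real"
      assume q: "\<And>m. 0 \<le> q m" "\<And>a. a \<in> F \<Longrightarrow> (\<Sum>m\<in>F \<times> F \<times> Z. q m * of_bool (fst m = a)) = w a"
        "\<And>b. b \<in> F \<Longrightarrow> (\<Sum>m\<in>F \<times> F \<times> Z. q m * of_bool (fst (snd m) = b)) = w b"
        "(\<Sum>m\<in>F \<times> F \<times> Z. q m *\<^sub>R D m) = Q"
      show "V + \<epsilon> < (\<Sum>m\<in>F \<times> F \<times> Z. q m * cost m)"
      proof (rule ccontr)
        assume "\<not> ?thesis"
        then have le: "(\<Sum>m\<in>F \<times> F \<times> Z. q m * cost m) \<le> V + \<epsilon>" by simp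
        from none show False by (rule notE) (intro exI[of _ q] conjI allI ballI q le)
      qed
    qed (assumption, rule that)
    from \<rho>[OF cF(1,2) uPa(1), of u P] uPa(2) show False
      unfolding cost_def D_def Z_def by (fastforce simp: not_le)
  qed
  then obtain q where q: "\<And>m. 0 \<le> q m"
      "\<And>a. a \<in> F \<Longrightarrow> (\<Sum>m\<in>F \<times> F \<times> Z. q m * of_bool (fst m = a)) = w a"
      "\<And>b. b \<in> F \<Longrightarrow> (\<Sum>m\<in>F \<times> F \<times> Z. q m * of_bool (fst (snd m) = b)) = w b"
      "(\<Sum>m\<in>F \<times> F \<times> Z. q m *\<^sub>R D m) = Q" "(\<Sum>m\<in>F \<times> F \<times> Z. q m * cost m) \<le> V + \<epsilon>" by blast
  have row: "(\<Sum>z\<in>Z. \<Sum>b\<in>F. q (a, b, z)) = w a" if "a \<in> F" for a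
  proof -
    have "w a = (\<Sum>a'\<in>F. if a' = a then \<Sum>b\<in>F. \<Sum>z\<in>Z. q (a, b, z) else 0)"
      unfolding q(2)[OF that, symmetric] sum_triples by (intro sum.cong) auto
    also have "\<dots> = (\<Sum>b\<in>F. \<Sum>z\<in>Z. q (a, b, z))" using that cF(1) by simp
    also have "\<dots> = (\<Sum>z\<in>Z. \<Sum>b\<in>F. q (a, b, z))" by (rule sum.swap)
    finally show ?thesis by simp
  qed
  have col: "(\<Sum>z\<in>Z. \<Sum>a\<in>F. q (a, b, z)) = w b" if "b \<in> F" for b
  proof -
    have "w b = (\<Sum>a\<in>F. \<Sum>b'\<in>F. if b' = b then \<Sum>z\<in>Z. q (a, b, z) else 0)"
      unfolding q(3)[OF that, symmetric] sum_triples by (intro sum.cong refl) auto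
    also have "\<dots> = (\<Sum>a\<in>F. \<Sum>z\<in>Z. q (a, b, z))" using that cF(1) by simp
    also have "\<dots> = (\<Sum>z\<in>Z. \<Sum>a\<in>F. q (a, b, z))" by (rule sum.swap)
    finally show ?thesis by simp
  qed
  interpret cells: coupled_cells \<theta> c F Z q w
    using \<theta> cF finZ q(1) row col by unfold_locales (auto simp: w_def Z_def)
  interpret coupling: prob_space cells.coupling by (rule cells.prob_space_coupling)
  let ?p = "plan_measure \<theta> cells.cell_plan"
  have in_plans: "cells.cell_plan \<in> plans \<theta> Q"
    using q(4) by (intro cells.cell_plan_in_plans) (simp add: D_def split_beta')
  have jump_bound: "norm (b - a + z) \<le> ?n + \<rho>" if "a \<in> torus_cube" "b \<in> torus_cube" "z \<in> Z" for a b z :: "real ^ 'n"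
    using norm_diff_torus_cube[OF that(1,2)] that(3) norm_triangle_ineq[of "b - a" z] by (simp add: Z_def)
  let ?L = "\<lambda>p. L (fst p) (cells.jump (fst p) (snd p))"
  let ?C = "\<lambda>p. cost (c (fst p), c (fst (snd p)), snd (snd p))"
  note L_meas = lagrangian_measurable[OF cont]
  have L_meas': "?L \<in> borel_measurable cells.coupling"
    unfolding measurable_cong_sets[OF cells.sets_coupling refl]
    using measurable_compose[OF cells.graph_measurable L_meas] by (simp add: split_beta')
  have "AE p in cells.coupling. norm (?L p) \<le> B"
  proof (rule AE_I2)
    fix p assume "p \<in> space cells.coupling"
    then have "snd (snd p) \<in> Z" by (auto simp: cells.space_coupling)
    from jump_bound[OF torus_rep_in_cube[of "fst p"] torus_rep_in_cube[of "fst (snd p)"] this]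
    show "norm (?L p) \<le> B"
      using B[OF torus_rep_in_cube[of "fst p"]] by (simp add: cells.jump_def)
  qed
  then have L_int': "integrable cells.coupling ?L"
    using L_meas' by (rule coupling.integrable_const_bound)
  then have L_int: "integrable ?p (\<lambda>(x, v). L x v)"
    using cells.integral_plan_measure_cell_plan(1)[OF L_meas] by simp
  have C_int: "integrable cells.coupling ?C"
    and C_val: "(\<integral>p. ?C p \<partial>cells.coupling) = (\<Sum>m\<in>F \<times> F \<times> Z. q m * cost m)"
    using cells.integral_coupling_cells[of cost] by (simp_all add: split_beta')
  have "fst \<in> cells.coupling \<rightarrow>\<^sub>M borel"
    unfolding measurable_cong_sets[OF cells.sets_coupling refl] by (rule measurable_fst)
  from AE_distrD[OF this] cF(5)
  have near_x: "AE p in cells.coupling. norm (torus_rep (fst p) - c (fst p)) \<le> \<delta>0 / 4"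
    unfolding cells.distr_coupling_fst by blast
  have "(\<lambda>p. fst (snd p)) \<in> cells.coupling \<rightarrow>\<^sub>M borel"
    unfolding measurable_cong_sets[OF cells.sets_coupling refl]
    by (rule measurable_compose[OF measurable_snd measurable_fst])
  from AE_distrD[OF this] cF(5)
  have near_y: "AE p in cells.coupling. norm (torus_rep (fst (snd p)) - c (fst (snd p))) \<le> \<delta>0 / 4"
    unfolding cells.distr_coupling_target by blast
  have close: "AE p in cells.coupling. ?L p \<le> ?C p + \<epsilon>"
    using near_x near_y AE_space
  proof eventually_elim
    case (elim p)
    obtain x y z where p: "p = (x, y, z)" by (cases p)
    have z: "z \<in> Z" using elim(3) by (simp add: p cells.space_coupling)
    let ?v = "torus_rep y - torus_rep x + z" and ?v' = "c y - c x + z"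
    have cc: "c x \<in> torus_cube" "c y \<in> torus_cube" using cF(2) cF_in by auto
    have in1: "(torus_rep x, ?v) \<in> ?K" using jump_bound[OF torus_rep_in_cube torus_rep_in_cube z] torus_rep_in_cube by simp
    have in2: "(c x, ?v') \<in> ?K" using jump_bound[OF cc z] cc by simp
    have nx: "norm (torus_rep x - c x) \<le> \<delta>0 / 4" and ny: "norm (torus_rep y - c y) \<le> \<delta>0 / 4"
      using elim by (simp_all add: p)
    have eq: "?v - ?v' = (torus_rep y - c y) - (torus_rep x - c x)" by simp
    have nv: "norm (?v - ?v') \<le> norm (torus_rep y - c y) + norm (torus_rep x - c x)"
      unfolding eq by (rule norm_triangle_ineq4)
    have "dist (torus_rep x, ?v) (c x, ?v') \<le> norm (torus_rep x - c x) + norm (?v - ?v')"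
      unfolding dist_norm diff_Pair by (rule norm_Pair_le)
    then have "dist (torus_rep x, ?v) (c x, ?v') \<le> \<delta>0 / 4 + (\<delta>0 / 4 + \<delta>0 / 4)"
      using nv nx ny by linarith
    then have "dist (torus_rep x, ?v) (c x, ?v') < \<delta>0" using \<delta>0(1) by simp
    from \<delta>0(2)[OF in2 in1 this] have "\<bar>L x ?v - L (abs_torus (c x)) ?v'\<bar> < \<epsilon>" by (simp add: dist_real_def)
    then show ?case by (simp add: p cells.jump_def cost_def)
  qed
  have "(\<integral>(x, v). L x v \<partial>?p) = (\<integral>p. ?L p \<partial>cells.coupling)"
    using cells.integral_plan_measure_cell_plan(2)[OF L_meas] by simp
  also have "\<dots> \<le> (\<integral>p. ?C p + \<epsilon> \<partial>cells.coupling)"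
    by (intro integral_mono_AE L_int' close Bochner_Integration.integrable_add C_int) simp
  also have "\<dots> = (\<Sum>m\<in>F \<times> F \<times> Z. q m * cost m) + \<epsilon>"
    using C_int C_val by (simp add: coupling.prob_space)
  also have "\<dots> \<le> V + 2 * \<epsilon>" using q(5) by simp
  finally have "(\<integral>(x, v). L x v \<partial>?p) \<le> V + 2 * \<epsilon>" .
  moreover have "ext_integral ?p (\<lambda>(x, v). ereal (L x v)) = ereal (\<integral>(x, v). L x v \<partial>?p)"
    using ext_integral_integrable[OF L_int] by (simp add: split_beta')
  ultimately show ?thesis using in_plans by (intro bexI[of _ cells.cell_plan]) simp_all
qed

theorem theorem5p3:
  fixes L :: "'n::finite torus \<Rightarrow> real ^ 'n \<Rightarrow> real" and \<gamma> :: real and Q :: "real ^ 'n"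
  assumes "\<gamma> > 0" and "lagrangian \<gamma> L"
  shows "minimax_lagrangian L Q =
    (SUP \<theta> \<in> space (prob_algebra (borel :: 'n torus measure)).
      SUP (P, u) \<in> UNIV \<times> {u :: 'n torus \<Rightarrow> real. continuous_on UNIV u}.
        ext_integral \<theta> (\<lambda>x. INF v. ereal (L x v + u (x +\<^sub>T v) - u x + P \<bullet> (v - Q))))"
proof -
  define dual where "dual P u x = (INF v. ereal (L x v + u (x +\<^sub>T v) - u x + P \<bullet> (v - Q)))" for P u x
  define W where "W = (SUP \<theta> \<in> space (prob_algebra (borel :: 'n torus measure)).
      SUP (P, u) \<in> UNIV \<times> {u :: 'n torus \<Rightarrow> real. continuous_on UNIV u}. ext_integral \<theta> (dual P u))"
  have "C_k 0 (\<lambda>(x, v). L (abs_torus x) v)"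
    using assms(2) unfolding lagrangian_def smooth_lagrangian_def by blast
  then have cont: "continuous_on UNIV (\<lambda>(x, v). L (abs_torus x) v)" by simp
  have conv: "\<And>x. strictly_convex (L x)"
    and coer: "\<And>x. filterlim (\<lambda>v. L x v / norm v) at_top at_infinity"
    using assms(2) unfolding lagrangian_def by blast+
  have superlinear: "\<exists>B. \<forall>x v. L x v \<ge> A * norm v - B" for A
    using torus_uniform_superlinear[OF cont conv coer, of A] by metis
  have W_upper: "ext_integral \<theta> (dual P u) \<le> W"
    if "\<theta> \<in> space (prob_algebra borel)" "continuous_on UNIV u" for \<theta> P u
    unfolding W_def using that by (intro SUP_upper2[of \<theta>] SUP_upper2[of "(P, u)"]) auto
  have dual_le_W: "dual P u x \<le> W" and dual_finite: "dual P u x \<noteq> - \<infinity>" if u: "continuous_on UNIV u" for P u x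
  proof -
    obtain m K where m: "m \<in> borel_measurable borel" "\<And>x. \<bar>m x\<bar> \<le> K" "\<And>x. dual P u x = ereal (m x)"
      by (rule dual_integrand_bounded[OF cont superlinear u, of P Q]) (rule that, unfold dual_def)
    show "dual P u x \<noteq> - \<infinity>" using m(3) by simp
    interpret r: prob_space "return borel x" by (rule prob_space_return) simp
    have mr: "m \<in> borel_measurable (return borel x)" using m(1) by simp
    have int: "integrable (return borel x) m"
      using mr m(2) by (intro r.integrable_const_bound[where B = K]) auto
    have "ext_integral (return borel x) (dual P u) = ereal (\<integral>y. m y \<partial>return borel x)"
      unfolding m(3)[abs_def] by (rule ext_integral_integrable[OF int])
    also have "(\<integral>y. m y \<partial>return borel x) = m x" using m(1) by (intro integral_return) auto
    finally have "dual P u x = ext_integral (return borel x) (dual P u)"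
      unfolding m(3)[of x] by (rule sym)
    also have "\<dots> \<le> W"
      using u r.prob_space_axioms by (intro W_upper) (auto simp: space_prob_algebra)
    finally show "dual P u x \<le> W" .
  qed
  have "minimax_lagrangian L Q \<le> W"
    unfolding minimax_lagrangian_def
  proof (rule SUP_least)
    fix \<theta> :: "'n torus measure" assume \<theta>: "\<theta> \<in> space (prob_algebra borel)"
    let ?I = "INF \<pi> \<in> plans \<theta> Q. ext_integral (plan_measure \<theta> \<pi>) (\<lambda>(x, v). ereal (L x v))"
    show "?I \<le> W"
    proof (cases W)
      case (real V)
      have val: "(INF v. ereal (L x v + u (x +\<^sub>T v) - u x + P \<bullet> (v - Q))) \<le> ereal V"
        if "continuous_on UNIV u" for P u x
        using dual_le_W[OF that, of P x] unfolding dual_def real .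
      show ?thesis
      proof (rule ereal_le_epsilon2)
        fix e :: real assume e: "0 < e"
        have e2: "e / 2 > 0" using e by simp
        have "\<exists>\<pi>\<in>plans \<theta> Q. ext_integral (plan_measure \<theta> \<pi>) (\<lambda>(x, v). ereal (L x v)) \<le> ereal (V + 2 * (e / 2))"
          by (rule near_optimal_plan[OF cont superlinear val \<theta> e2])
        then obtain \<pi> where \<pi>: "\<pi> \<in> plans \<theta> Q"
          "ext_integral (plan_measure \<theta> \<pi>) (\<lambda>(x, v). ereal (L x v)) \<le> ereal (V + 2 * (e / 2))" by blast
        have "?I \<le> ext_integral (plan_measure \<theta> \<pi>) (\<lambda>(x, v). ereal (L x v))"
          using \<pi>(1) by (rule INF_lower)
        also note \<pi>(2)
        finally have "?I \<le> ereal (V + 2 * (e / 2))" .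
        then show "?I \<le> W + ereal e" by (simp add: real)
      qed
    next
      case MInf
      have "dual 0 (\<lambda>_. 0) (abs_torus 0) \<le> W" "dual 0 (\<lambda>_. 0) (abs_torus 0) \<noteq> - \<infinity>"
        by (rule dual_le_W dual_finite; simp)+
      then show ?thesis using MInf by simp
    qed simp
  qed
  moreover have "W \<le> minimax_lagrangian L Q"
    unfolding W_def minimax_lagrangian_def
  proof (rule SUP_mono)
    fix \<theta> :: "'n torus measure" assume \<theta>: "\<theta> \<in> space (prob_algebra borel)"
    have "(SUP (P, u) \<in> UNIV \<times> {u. continuous_on UNIV u}. ext_integral \<theta> (dual P u))
        \<le> (INF \<pi> \<in> plans \<theta> Q. ext_integral (plan_measure \<theta> \<pi>) (\<lambda>(x, v). ereal (L x v)))"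
      unfolding dual_def using dual_value_le_plan_cost[OF cont superlinear \<theta>]
      by (intro SUP_least INF_greatest) auto
    then show "\<exists>\<theta>'\<in>space (prob_algebra borel).
        (SUP (P, u) \<in> UNIV \<times> {u. continuous_on UNIV u}. ext_integral \<theta> (dual P u))
        \<le> (INF \<pi> \<in> plans \<theta>' Q. ext_integral (plan_measure \<theta>' \<pi>) (\<lambda>(x, v). ereal (L x v)))"
      using \<theta> by blast
  qed
  ultimately show ?thesis by (simp add: W_def dual_def[abs_def])
qed

end
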